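(* Let $\Theta$ be an open set in $\mathbb R^d$, suppose that the map $\theta\mapsto H_\theta$ from $\Theta$ to $E$ is continuously Hadamard differentiable, and assume that $\inf_{\theta\in\Theta}\|H-H_\theta\|_E>0$ for every $H\in\mathcal H_1$. Let $R_n=H_{\hat\theta_n}$ and $\theta_n^*=\hat\theta_n(X_1^*,\dots,X_n^* )$ for a sequence of estimators $\hat\theta_n=\hat\theta_n(X_1,\dots,X_n)$. Consider the following conditions, for a probability distribution $H$ and $\theta(H)\in\Theta$, with $\theta_0:=\theta(H)$: (B1) under $H$, $\sqrt n\,(\mathbb H_n-H,\hat\theta_n-\theta(H))\rightsquigarrow(\mathbb G_H,U_H)$ in $E\times\mathbb R^d$; (C1) for every converging sequence $h_n\to h$ in $\mathbb R^d$, when $X_1,\dots,X_n$ is an i.i.d. sample from $H_{\theta_0+h_n/\sqrt n}$, $\sqrt n\,(\mathbb H_n-H_{\theta_0+h_n/\sqrt n},\hat\theta_n-\theta_0-h_n/\sqrt n)\rightsquigarrow(\mathbb G_{H_{\theta_0}},U_{H_{\theta_0}})$ in $E\times\mathbb R^d$; (C2) for every sequence $\theta_{0,n}\to\theta_0$, when $X_1,\dots,X_n$ is an i.i.d. sample from $H_{\theta_{0,n}}$, $\sqrt n\,(\mathbb H_n-H_{\theta_{0,n}},\hat\theta_n-\theta_{0,n})\rightsquigarrow(\mathbb G_{H_{\theta_0}},U_{H_{\theta_0}})$ in $E\times\mathbb R^d$. Suppose that for every $H$ there exists $\theta(H)\in\Theta$ such that (B1) and (C1) hold. Let $\alpha\in(0,1)$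 be such that, for $H\in\mathcal H_0$, the variable $\|\mathbb G_H-\dot H_{\theta(H)}U_H\|_E$ does not have an atom at its $(1-\alpha)$-quantile. Then $P(T_n\ge\xi^*_{n,1-\alpha})\to\alpha$ if $H\in\mathcal H_0$, and $P_{o}(T_n>\xi^*_{n,1-\alpha})\to1$ if $H\in\mathcal H_1$. This remains valid if (B1) holds for every $H\in\mathcal H_0$, and (C2) holds and $\hat\theta_n\to\theta(H)$ in probability under $H$, for every $H$.
   Context: Setting (goodness-of-fit testing). $X_1,\dots,X_n$ are i.i.d. with distribution $H$ in a measurable space $(\mathcal X,\mathcal A)$; "every $H$" refers to every probability distribution under consideration (typically all probability distributions on $\mathcal X$). Probability measures on $\mathcal X$ are embedded in a normed space $(E,\|\cdot\|_E)$. The hypotheses are $\mathcal H_0: H\in\{H_\theta:\theta\in\Theta\}$ and $\mathcal H_1:H\notin\{H_\theta:\theta\in\Theta\}$. The parameter $\theta(H)$ is such that $H=H_{\theta(H)}$ for $H\in\mathcal H_0$. $\dot H_\theta:\mathbb R^d\to E$ is the derivative of $\theta\mapsto H_\theta$. $\mathbb H_n=n^{-1}\sum_{i=1}^n\delta_{X_i}$. Given $X_1,\dots,X_n$, the bootstrap values $X_1^*,\dots,X_n^*$ are i.i.d. from $R_n=H_{\hat\theta_n}$, and $\mathbb H_n^*=n^{-1}\sum_{i=1}^n\delta_{X_i^*}$. The statistics are $$T_n=\sqrt n\,\|\mathbb H_n-H_{\hat\theta_n}\|_E,\qquad T_n^*=\sqrt n\,\|\mathbb H_n^*-H_{\theta_n^*}-R_n+H_{\hat\theta_n}\|_E=\sqrt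 n\,\|\mathbb H_n^*-H_{\theta_n^*}\|_E,$$ and $\xi^*_{n,1-\alpha}$ is the $(1-\alpha)$-quantile of the conditional distribution of $T_n^*$ given $X_1,\dots,X_n$ (it is assumed that these can be defined in a measurable way). Formally, $X_1,\dots,X_n$ are the coordinate projections on the first factor of a product probability space $(\mathcal X^n,\mathcal A^n,H^n)\times(\mathcal Z,\mathcal C,Q)$, and the $X_i^*$ are measurable maps on this product which, for fixed $(x_1,\dots,x_n)$, are i.i.d. $R_n(x_1,\dots,x_n)$ under $Q$. $P_{o}$ is inner probability. All limit variables are tight Borel measurable random elements. $\rightsquigarrow$ is weak convergence in the Hoffmann-Jørgensen sense: for possibly non-measurable maps $Y_n$ into a metric space $M$ and a Borel measurable $Y$, $Y_n\rightsquigarrow Y$ means $\mathbb E^{o}h(Y_n)\to\mathbb E h(Y)$ for every bounded continuous $h:M\to\mathbb R$, with $\mathbb E^{o}$ outer expectation. Hadamard differentiability of $\theta\mapsto H_\theta$ at $\theta$: $t_n^{-1}(H_{\theta+t_nh_n}-H_\theta)\to\dot H_\theta h$ in $E$ for all $t_n\to0$ in $\mathbb R$ and $h_n\to h$ in $\mathbb R^d$ with $\theta+t_nh_n\in\Theta$, where $\dot H_\theta$ is linear and continuous; continuously Hadamard differentiable means that moreover $\theta\mapsto\dot H_\theta$ is continuous.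
   Formalization: The embedding in E is assumed to be given by integration: along a separating family of continuous functionals, the image of P is the P-integral of the images of point masses; and "no atom at its (1−α)-quantile" is required at every (1−α)-quantile when this is not unique. *)

theory Defs
  imports "HOL-Probability.Probability"
begin

text \<open>Outer expectation of a bounded, possibly non-measurable function. (The library integral of a
  non-measurable function is a default value, or a lower integral in the case of \<open>nn_integral\<close>.)\<close>

definition outer_expectation :: "'a measure \<Rightarrow> ('a \<Rightarrow> real) \<Rightarrow> real" where
  "outer_expectation M f =
     Inf {integral\<^sup>L M g | g. integrable M g \<and> (\<forall>x\<in>space M. f x \<le> g x)}"

text \<open>The outer probability is the library's \<open>outer_measure_of\<close>; this is its inner counterpart.\<close>

definition inner_measure_of :: "'a measure \<Rightarrow> 'a set \<Rightarrow> ennreal" where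
  "inner_measure_of M B = (SUP C \<in> {C \<in> sets M. C \<subseteq> B}. emeasure M C)"

text \<open>Weak convergence in the sense of Hoffmann-Jorgensen; the n-th map lives on its own
  probability space \<open>M n\<close>.\<close>

definition HJ_weak_conv ::
    "(nat \<Rightarrow> 'a measure) \<Rightarrow> (nat \<Rightarrow> 'a \<Rightarrow> 'm::metric_space) \<Rightarrow> 'w measure \<Rightarrow> ('w \<Rightarrow> 'm) \<Rightarrow> bool" where
  "HJ_weak_conv M Y N Z \<longleftrightarrow>
     Z \<in> borel_measurable N \<and>
     (\<forall>h::'m \<Rightarrow> real. continuous_on UNIV h \<and> bounded (range h) \<longrightarrow>
        (\<lambda>n. outer_expectation (M n) (\<lambda>x. h (Y n x))) \<longlonglongrightarrow> (\<integral>w. h (Z w) \<partial>N))"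

definition tight_random_element :: "'w measure \<Rightarrow> ('w \<Rightarrow> 'm::metric_space) \<Rightarrow> bool" where
  "tight_random_element N Z \<longleftrightarrow>
     prob_space N \<and> Z \<in> borel_measurable N \<and>
     (\<forall>\<epsilon>>0. \<exists>K. compact K \<and> measure N {w \<in> space N. Z w \<in> K} \<ge> 1 - \<epsilon>)"

text \<open>\<open>t\<close> is a \<open>p\<close>-quantile of \<open>\<mu>\<close>. Quantiles need not be unique: they form the interval of all \<open>t\<close>
  with \<open>F(t-) \<le> p \<le> F(t)\<close>, whose left end point is \<open>inf {t. p \<le> F t}\<close>.
  'No atom at the quantile' is required at every such \<open>t\<close>; if \<open>F\<close> is flat at level \<open>p\<close>, excluding
  an atom at the left end point alone would not control the level of a bootstrap test.\<close>

definition is_quantile :: "real measure \<Rightarrow> real \<Rightarrow> real \<Rightarrow> bool" where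
  "is_quantile \<mu> p t \<longleftrightarrow> measure \<mu> {..<t} \<le> p \<and> p \<le> measure \<mu> {..t}"

text \<open>Samples of size \<open>n\<close> are points of \<open>\<Pi>\<^sub>M i\<in>{..<n}. A\<close>, that is, functions on \<open>{..<n}\<close>.\<close>

definition empirical :: "'x measure \<Rightarrow> nat \<Rightarrow> (nat \<Rightarrow> 'x) \<Rightarrow> 'x measure" where
  "empirical A n x =
     measure_of (space A) (sets A) (\<lambda>B. (\<Sum>i<n. emeasure (return A (x i)) B) / of_nat n)"

lemma empirical_eq_distr:
  assumes "1 \<le> n" "x \<in> space (\<Pi>\<^sub>M i\<in>{..<n}. A)"
  shows "empirical A n x = distr (uniform_count_measure {..<n}) A x"
proof -
  have xs: "\<And>i. i < n \<Longrightarrow> x i \<in> space A" using assms(2) by (auto simp: space_PiM)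
  have m: "x \<in> uniform_count_measure {..<n} \<rightarrow>\<^sub>M A"
    using xs by (auto simp: measurable_def sets_uniform_count_measure space_uniform_count_measure)
  have eq: "emeasure (distr (uniform_count_measure {..<n}) A x) B
      = (\<Sum>i<n. emeasure (return A (x i)) B) / of_nat n" if B: "B \<in> sets A" for B
  proof -
    have "(\<Sum>i<n. emeasure (return A (x i)) B) = of_nat (card (x -` B \<inter> {..<n}))"
      using B by (simp add: indicator_def sum.If_cases Int_def vimage_def conj_commute
        flip: sum.inter_filter)
    moreover have "emeasure (distr (uniform_count_measure {..<n}) A x) B = of_nat (card (x -` B \<inter> {..<n})) / of_nat n"
      using B m assms(1) by (simp add: emeasure_distr space_uniform_count_measure emeasure_uniform_count_measure
         divide_ennreal ennreal_of_nat_eq_real_of_nat)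
    ultimately show ?thesis by simp
  qed
  have "empirical A n x = measure_of (space A) (sets A) (emeasure (distr (uniform_count_measure {..<n}) A x))"
    unfolding empirical_def by (rule measure_of_eq) (auto simp: sets.space_closed sets.sigma_sets_eq eq)
  also have "\<dots> = distr (uniform_count_measure {..<n}) A x"
    using measure_of_of_measure[of "distr (uniform_count_measure {..<n}) A x"] by simp
  finally show ?thesis .
qed

text \<open>An embedding of the distributions \<open>D\<close> and of all empirical measures in a normed space: up to a
  separating family of continuous linear functionals, the image of \<open>P\<close> is the integral of the images
  of the point masses. The typical case is \<open>P \<mapsto> (\<integral>f dP)\<^sub>f\<close> with values in the bounded functions on
  a class of functions \<open>f\<close>, where the functionals are the coordinate projections; mean embeddings
  are another. In particular the map respects mixtures. It need not be one-to-one (the class of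
  functions may fail to determine a measure).\<close>

definition measure_embedding ::
    "'x measure \<Rightarrow> 'x measure set \<Rightarrow> ('x measure \<Rightarrow> 'e::real_normed_vector) \<Rightarrow> bool" where
  "measure_embedding A D emb \<longleftrightarrow>
     (\<exists>\<Phi> :: ('e \<Rightarrow>\<^sub>L real) set.
        (\<forall>u. (\<forall>\<phi>\<in>\<Phi>. blinfun_apply \<phi> u = 0) \<longrightarrow> u = 0) \<and>
        (\<forall>\<phi>\<in>\<Phi>. \<forall>P \<in> D \<union> {empirical A n x | n x. 1 \<le> n \<and> x \<in> space (\<Pi>\<^sub>M i\<in>{..<n}. A)}.
            integrable P (\<lambda>y. blinfun_apply \<phi> (emb (return A y))) \<and>
            blinfun_apply \<phi> (emb P) = (\<integral>y. blinfun_apply \<phi> (emb (return A y)) \<partial>P)))"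

definition hadamard_derivative_at ::
    "('a::real_normed_vector \<Rightarrow> 'e::real_normed_vector) \<Rightarrow> ('a \<Rightarrow>\<^sub>L 'e) \<Rightarrow> 'a \<Rightarrow> 'a set \<Rightarrow> bool" where
  "hadamard_derivative_at f f' a S \<longleftrightarrow>
     (\<forall>(t::nat \<Rightarrow> real) h l.
        t \<longlonglongrightarrow> 0 \<and> (\<forall>n. t n \<noteq> 0) \<and> h \<longlonglongrightarrow> l \<and> (\<forall>n. a + t n *\<^sub>R h n \<in> S) \<longrightarrow>
        (\<lambda>n. (f (a + t n *\<^sub>R h n) - f a) /\<^sub>R t n) \<longlonglongrightarrow> blinfun_apply f' l)"

definition continuously_hadamard_differentiable ::
    "('a::real_normed_vector \<Rightarrow> 'e::real_normed_vector) \<Rightarrow> ('a \<Rightarrow> 'a \<Rightarrow>\<^sub>L 'e) \<Rightarrow> 'a set \<Rightarrow> bool" where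
  "continuously_hadamard_differentiable f f' S \<longleftrightarrow>
     (\<forall>a\<in>S. hadamard_derivative_at f (f' a) a S) \<and> continuous_on S f'"

text \<open>Below, \<open>\<theta>est n\<close> is the estimator based on samples of size \<open>n\<close>. The following says that if, for
  each \<open>n\<close>, the sample of size \<open>n\<close> is drawn from \<open>K n\<close>, then
  \<open>\<surd>n (\<bbbH>\<^sub>n - K n, \<theta>est\<^sub>n - \<theta> n)\<close> converges weakly to \<open>Z\<close>.\<close>

definition joint_limit ::
    "'x measure \<Rightarrow> ('x measure \<Rightarrow> 'e::real_normed_vector) \<Rightarrow> (nat \<Rightarrow> (nat \<Rightarrow> 'x) \<Rightarrow> real^'d) \<Rightarrow>
     (nat \<Rightarrow> 'x measure) \<Rightarrow> (nat \<Rightarrow> real^'d) \<Rightarrow> 'w measure \<Rightarrow> ('w \<Rightarrow> 'e \<times> (real^'d)) \<Rightarrow> bool" where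
  "joint_limit A emb \<theta>est K \<theta> N Z \<longleftrightarrow>
     HJ_weak_conv (\<lambda>n. \<Pi>\<^sub>M i\<in>{..<n}. K n)
       (\<lambda>n x. sqrt (real n) *\<^sub>R (emb (empirical A n x) - emb (K n), \<theta>est n x - \<theta> n)) N Z"

definition cond_B1 ::
    "'x measure \<Rightarrow> ('x measure \<Rightarrow> 'e::real_normed_vector) \<Rightarrow> (nat \<Rightarrow> (nat \<Rightarrow> 'x) \<Rightarrow> real^'d) \<Rightarrow>
     'x measure \<Rightarrow> real^'d \<Rightarrow> 'w measure \<Rightarrow> ('w \<Rightarrow> 'e \<times> (real^'d)) \<Rightarrow> bool" where
  "cond_B1 A emb \<theta>est H \<theta>\<^sub>0 N Z \<longleftrightarrow> joint_limit A emb \<theta>est (\<lambda>_. H) (\<lambda>_. \<theta>\<^sub>0) N Z"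

text \<open>In the next two conditions the perturbed parameters lie in the open parameter set only for all
  sufficiently large \<open>n\<close>; the remaining finitely many terms do not affect the limit.\<close>

definition cond_C1 ::
    "'x measure \<Rightarrow> ('x measure \<Rightarrow> 'e::real_normed_vector) \<Rightarrow> (nat \<Rightarrow> (nat \<Rightarrow> 'x) \<Rightarrow> real^'d) \<Rightarrow>
     (real^'d \<Rightarrow> 'x measure) \<Rightarrow> real^'d \<Rightarrow> 'w measure \<Rightarrow> ('w \<Rightarrow> 'e \<times> (real^'d)) \<Rightarrow> bool" where
  "cond_C1 A emb \<theta>est Hm \<theta>\<^sub>0 N Z \<longleftrightarrow>
     (\<forall>h l. h \<longlonglongrightarrow> l \<longrightarrow>
        joint_limit A emb \<theta>est (\<lambda>n. Hm (\<theta>\<^sub>0 + h n /\<^sub>R sqrt (real n)))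
          (\<lambda>n. \<theta>\<^sub>0 + h n /\<^sub>R sqrt (real n)) N Z)"

definition cond_C2 ::
    "'x measure \<Rightarrow> ('x measure \<Rightarrow> 'e::real_normed_vector) \<Rightarrow> (nat \<Rightarrow> (nat \<Rightarrow> 'x) \<Rightarrow> real^'d) \<Rightarrow>
     (real^'d \<Rightarrow> 'x measure) \<Rightarrow> real^'d \<Rightarrow> 'w measure \<Rightarrow> ('w \<Rightarrow> 'e \<times> (real^'d)) \<Rightarrow> bool" where
  "cond_C2 A emb \<theta>est Hm \<theta>\<^sub>0 N Z \<longleftrightarrow>
     (\<forall>\<theta>. \<theta> \<longlonglongrightarrow> \<theta>\<^sub>0 \<longrightarrow> joint_limit A emb \<theta>est (\<lambda>n. Hm (\<theta> n)) \<theta> N Z)"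

definition consistent_under ::
    "(nat \<Rightarrow> (nat \<Rightarrow> 'x) \<Rightarrow> real^'d) \<Rightarrow> 'x measure \<Rightarrow> real^'d \<Rightarrow> bool" where
  "consistent_under \<theta>est H \<theta>\<^sub>0 \<longleftrightarrow>
     (\<forall>\<epsilon>>0. (\<lambda>n. outer_measure_of (\<Pi>\<^sub>M i\<in>{..<n}. H)
                   {x \<in> space (\<Pi>\<^sub>M i\<in>{..<n}. H). dist (\<theta>est n x) \<theta>\<^sub>0 > \<epsilon>}) \<longlonglongrightarrow> 0)"

text \<open>\<open>Xs x z\<close> is the bootstrap sample of size \<open>n\<close>; \<open>x\<close> is the original sample, \<open>z\<close> the auxiliary
  randomness with law \<open>Q\<close>, and \<open>R x\<close> the resampling law given \<open>x\<close>.\<close>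

definition bootstrap_sample ::
    "'x measure \<Rightarrow> 'z measure \<Rightarrow> nat \<Rightarrow> ((nat \<Rightarrow> 'x) \<Rightarrow> 'x measure) \<Rightarrow>
     ((nat \<Rightarrow> 'x) \<Rightarrow> 'z \<Rightarrow> (nat \<Rightarrow> 'x)) \<Rightarrow> bool" where
  "bootstrap_sample A Q n R Xs \<longleftrightarrow>
     (\<lambda>(x, z). Xs x z) \<in> (\<Pi>\<^sub>M i\<in>{..<n}. A) \<Otimes>\<^sub>M Q \<rightarrow>\<^sub>M (\<Pi>\<^sub>M i\<in>{..<n}. A) \<and>
     (\<forall>x \<in> space (\<Pi>\<^sub>M i\<in>{..<n}. A).
        prob_space.indep_vars Q (\<lambda>_. A) (\<lambda>i z. Xs x z i) {..<n} \<and>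
        (\<forall>i<n. distr Q A (\<lambda>z. Xs x z i) = R x))"

definition gof_stat ::
    "'x measure \<Rightarrow> ('x measure \<Rightarrow> 'e::real_normed_vector) \<Rightarrow> (real^'d \<Rightarrow> 'x measure) \<Rightarrow>
     (nat \<Rightarrow> (nat \<Rightarrow> 'x) \<Rightarrow> real^'d) \<Rightarrow> nat \<Rightarrow> (nat \<Rightarrow> 'x) \<Rightarrow> real" where
  "gof_stat A emb Hm \<theta>est n x =
     sqrt (real n) * norm (emb (empirical A n x) - emb (Hm (\<theta>est n x)))"

text \<open>The bootstrap statistic for original sample \<open>x\<close> and bootstrap sample \<open>y\<close>, when resampling
  from \<open>R x\<close>.\<close>

definition boot_stat ::
    "'x measure \<Rightarrow> ('x measure \<Rightarrow> 'e::real_normed_vector) \<Rightarrow> (real^'d \<Rightarrow> 'x measure) \<Rightarrow>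
     (nat \<Rightarrow> (nat \<Rightarrow> 'x) \<Rightarrow> real^'d) \<Rightarrow> ((nat \<Rightarrow> 'x) \<Rightarrow> 'x measure) \<Rightarrow>
     nat \<Rightarrow> (nat \<Rightarrow> 'x) \<Rightarrow> (nat \<Rightarrow> 'x) \<Rightarrow> real" where
  "boot_stat A emb Hm \<theta>est R n x y =
     sqrt (real n) *
       norm (emb (empirical A n y) - emb (Hm (\<theta>est n y)) - emb (R x) + emb (Hm (\<theta>est n x)))"

lemma boot_stat_eq_gof_stat:
  "boot_stat A emb Hm \<theta>est (\<lambda>x. Hm (\<theta>est n x)) n x y = gof_stat A emb Hm \<theta>est n y"
  by (simp add: boot_stat_def gof_stat_def)

end

theory Submission
  imports Defs
begin

text \<open>Given the sample \<open>x\<close>, the bootstrap statistic is distributed as the statistic \<open>T\<^sub>n\<close> of a fresh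
  sample from the model at the estimate \<open>\<theta>est n x\<close>. So two things are to be understood: the law of
  \<open>T\<^sub>n\<close> when the data come from a parameter that varies with \<open>n\<close>, and the passage from such
  deterministic parameters to the random parameter \<open>\<theta>est n x\<close>.

  For the first, let \<open>\<theta>s n\<close> converge to \<open>\<theta>\<^sub>0\<close> such that \<open>\<surd>n (\<bbbH>\<^sub>n - Hm \<theta>s, \<theta>est - \<theta>s)\<close> converges weakly to
  \<open>(G, U)\<close>. Continuous Hadamard differentiability makes the model strictly differentiable at \<open>\<theta>\<^sub>0\<close>
  (\<open>continuously_hadamard_imp_strict_derivative\<close>), hence \<open>T\<^sub>n\<close> is, up to a negligible error, the norm of
  the first component minus the derivative at \<open>\<theta>\<^sub>0\<close> of the second, and its tails are those of
  \<open>norm (G - dH \<theta>\<^sub>0 U)\<close> in the limit (\<open>gof_stat_signed_tail\<close>). Outer probabilities are compared with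
  tails of the limit at slightly different levels, which a single continuous test function
  achieves (\<open>HJ_weak_conv_outer_measure_ge\<close>).

  For the second, a statement that holds eventually along every admissible sequence holds uniformly
  over compact sets, respectively over a neighbourhood of the limit
  (\<open>eventually_ball_if_eventually_along_sequences\<close>). Under the first set of conditions the rescaled
  errors of the estimator are tight, under the second one the estimator is consistent; either way
  the property \<open>sequences_control\<close> results. It confines the critical values, with probability tending
  to one, to any neighbourhood of the interval of \<open>(1 - \<alpha>)\<close>-quantiles of \<open>norm (G - dH \<theta>\<^sub>0 U)\<close>.

  Under the null hypothesis \<open>T\<^sub>n\<close> itself has this limit law, and because the quantiles are not atoms,
  the rejection probability tends to \<open>\<alpha>\<close> (\<open>asymptotic_level\<close>). Under the alternative the critical values
  stay bounded while \<open>T\<^sub>n\<close> tends to infinity at rate \<open>\<surd>n\<close> (\<open>asymptotic_power\<close>). The second set of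
  conditions does not say that the empirical measure approaches \<open>H\<close> in the norm there. Instead one
  of the functionals that define the embedding separates \<open>H\<close> from the limit of the fitted models,
  and along it the empirical measure obeys the weak law of large numbers for integrable variables.\<close>

section \<open>Outer and inner measure\<close>

lemma outer_measure_of_subset_Un_le:
  assumes "C \<subseteq> A \<union> B" "A \<subseteq> space M" "B \<subseteq> space M"
  shows "outer_measure_of M C \<le> outer_measure_of M A + outer_measure_of M B"
proof -
  obtain E F where E: "E \<in> sets M" "A \<subseteq> E" "outer_measure_of M A = emeasure M E"
    and F: "F \<in> sets M" "B \<subseteq> F" "outer_measure_of M B = emeasure M F"
    using outer_measure_of_attain assms(2,3) by metis
  have "outer_measure_of M C \<le> outer_measure_of M (E \<union> F)"
    using assms(1) E F by (intro outer_measure_of_mono) auto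
  also have "\<dots> \<le> emeasure M E + emeasure M F"
    using E F by (simp add: emeasure_subadditive)
  finally show ?thesis using E F by simp
qed

text \<open>This is how a limit theorem for outer probabilities on the sample space is applied to a
  resampled statistic, which is measurable only as a function of the auxiliary randomness.\<close>

lemma outer_measure_of_vimage_le:
  assumes f: "f \<in> M \<rightarrow>\<^sub>M N" and B: "B \<subseteq> space N"
  shows "outer_measure_of M (f -` B \<inter> space M) \<le> outer_measure_of (distr M N f) B"
proof -
  obtain E where E: "E \<in> sets N" "B \<subseteq> E" "outer_measure_of (distr M N f) B = emeasure (distr M N f) E"
    using outer_measure_of_attain[of B "distr M N f"] B by auto
  have "outer_measure_of M (f -` B \<inter> space M) \<le> outer_measure_of M (f -` E \<inter> space M)"
    using E by (intro outer_measure_of_mono) auto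
  also have "\<dots> = emeasure (distr M N f) E"
    using E f by (simp add: emeasure_distr)
  finally show ?thesis using E by simp
qed

lemma outer_measure_of_times_space_le:
  assumes Q: "prob_space Q" and B: "B \<subseteq> space M"
  shows "outer_measure_of (M \<Otimes>\<^sub>M Q) (B \<times> space Q) \<le> outer_measure_of M B"
proof -
  interpret Q: prob_space Q by fact
  obtain E where E: "E \<in> sets M" "B \<subseteq> E" "outer_measure_of M B = emeasure M E"
    using outer_measure_of_attain[OF B] by auto
  have "outer_measure_of (M \<Otimes>\<^sub>M Q) (B \<times> space Q) \<le> outer_measure_of (M \<Otimes>\<^sub>M Q) (E \<times> space Q)"
    using E by (intro outer_measure_of_mono) auto
  also have "\<dots> = emeasure M E"
    using E by (simp add: Q.emeasure_pair_measure_Times Q.emeasure_space_1)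
  finally show ?thesis using E by simp
qed

lemma inner_measure_of_le_outer:
  "inner_measure_of M B \<le> outer_measure_of M B"
  unfolding inner_measure_of_def
  by (auto intro!: SUP_least dest: outer_measure_of_mono[of _ B M])

text \<open>The complement of a measurable cover of the complement of \<open>B\<close> lies inside \<open>B\<close>.\<close>

lemma inner_measure_of_ge:
  assumes M: "prob_space M" and B: "B \<subseteq> space M"
    and c: "outer_measure_of M (space M - B) \<le> ennreal c" "0 \<le> c"
  shows "ennreal (1 - c) \<le> inner_measure_of M B"
proof -
  interpret prob_space M by fact
  obtain E where E: "E \<in> sets M" "space M - B \<subseteq> E" "outer_measure_of M (space M - B) = emeasure M E"
    using outer_measure_of_attain[of "space M - B" M] by auto
  have "measure M E \<le> c"
    using c E by (simp add: emeasure_eq_measure)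
  hence "1 - c \<le> measure M (space M - E)"
    using E by (simp add: prob_compl)
  hence "ennreal (1 - c) \<le> emeasure M (space M - E)"
    by (simp add: emeasure_eq_measure ennreal_leI)
  also have "\<dots> \<le> inner_measure_of M B"
    unfolding inner_measure_of_def using E by (intro SUP_upper) auto
  finally show ?thesis .
qed

text \<open>Markov's inequality for each measurable majorant of \<open>f\<close>. The upper bound \<open>b\<close> guarantees that
  there are integrable majorants, so that the infimum of their integrals is a genuine one.\<close>

lemma outer_measure_of_le_outer_expectation:
  assumes M: "prob_space M" and B: "B \<subseteq> space M"
    and f0: "\<And>x. x \<in> space M \<Longrightarrow> 0 \<le> f x" and fb: "\<And>x. x \<in> space M \<Longrightarrow> f x \<le> b"
    and f1: "\<And>x. x \<in> B \<Longrightarrow> 1 \<le> f x"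
  shows "outer_measure_of M B \<le> ennreal (outer_expectation M f)"
proof (rule ennreal_le_epsilon)
  interpret prob_space M by fact
  let ?S = "{integral\<^sup>L M g | g. integrable M g \<and> (\<forall>x\<in>space M. f x \<le> g x)}"
  have ne: "?S \<noteq> {}" using fb by (auto intro!: exI[of _ "\<lambda>_. b"])
  have nonneg: "0 \<le> v" if "v \<in> ?S" for v
    using that f0 by (fastforce intro: integral_nonneg_AE)
  have "0 \<le> outer_expectation M f"
    unfolding outer_expectation_def using ne nonneg by (intro cInf_greatest) auto
  fix e :: real assume e: "0 < e"
  have "Inf ?S < outer_expectation M f + e"
    unfolding outer_expectation_def using e by simp
  from cInf_lessD[OF ne this] obtain g where g: "integrable M g" "\<And>x. x \<in> space M \<Longrightarrow> f x \<le> g x"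
    "integral\<^sup>L M g < outer_expectation M f + e" by auto
  have [measurable]: "g \<in> borel_measurable M" using g by auto
  have g1: "1 \<le> g x" if "x \<in> B" for x using f1[OF that] g(2)[of x] B that by auto
  have g0: "0 \<le> g x" if "x \<in> space M" for x using f0[OF that] g(2)[OF that] by simp
  have "outer_measure_of M B \<le> outer_measure_of M {x \<in> space M. g x \<ge> 1}"
    using B g1 by (intro outer_measure_of_mono) auto
  also have "\<dots> = emeasure M {x \<in> space M. g x \<ge> 1}" by simp
  also have "\<dots> \<le> ennreal (1 / 1 * integral\<^sup>L M g)"
    using g(1) g0 by (intro integral_Markov_inequality) auto
  also have "\<dots> \<le> ennreal (outer_expectation M f + e)"
    using g by (intro ennreal_leI) simp
  also have "\<dots> = ennreal (outer_expectation M f) + ennreal e"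
    using e \<open>0 \<le> outer_expectation M f\<close> by simp
  finally show "outer_measure_of M B \<le> ennreal (outer_expectation M f) + ennreal e" .
qed

lemma tendsto_ennreal_if_eventually_between:
  assumes "\<And>\<epsilon>::real. 0 < \<epsilon> \<Longrightarrow> \<forall>\<^sub>F n in F. f n \<le> ennreal (c + \<epsilon>)"
    and "\<And>\<epsilon>::real. 0 < \<epsilon> \<Longrightarrow> \<forall>\<^sub>F n in F. ennreal (c - \<epsilon>) \<le> f n" and c: "0 \<le> c"
  shows "(f \<longlongrightarrow> ennreal c) F"
proof (rule order_tendstoI)
  fix a assume a: "a < ennreal c"
  then obtain r where r: "a = ennreal r" "0 \<le> r" by (cases a) auto
  hence rc: "r < c" using a by (simp add: ennreal_less_iff)
  have "ennreal r < ennreal (c - (c - r) / 2)" using r rc by (simp add: ennreal_less_iff field_simps)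
  thus "\<forall>\<^sub>F n in F. a < f n"
    using assms(2)[of "(c - r) / 2"] rc r by (auto elim!: eventually_mono)
next
  fix a assume a: "ennreal c < a"
  then obtain d where d: "ennreal c < d" "d < a" using dense by blast
  then obtain r where r: "d = ennreal r" "0 \<le> r" by (cases d) auto
  hence rc: "c < r" using d c by (simp add: ennreal_less_iff)
  have "\<forall>\<^sub>F n in F. f n \<le> ennreal (c + (r - c))" using rc by (intro assms(1)) simp
  thus "\<forall>\<^sub>F n in F. f n < a" using d r by (auto elim!: eventually_mono)
qed

section \<open>Weak convergence of possibly non-measurable maps\<close>

text \<open>A quantitative half of the portmanteau theorem. The gap between \<open>a\<close> and \<open>b\<close> leaves room for one
  continuous function between the two indicators, so that no limit of test functions has to be
  taken; all later arguments can afford such a gap.\<close>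

lemma HJ_weak_conv_outer_measure_ge:
  fixes \<psi> :: "'m::metric_space \<Rightarrow> real"
  assumes W: "HJ_weak_conv M Y N Z" and N: "prob_space N"
    and M: "\<forall>\<^sub>F n in sequentially. prob_space (M n)"
    and \<psi>: "continuous_on UNIV \<psi>" and ab: "a < b"
    and c: "measure N {w \<in> space N. \<psi> (Z w) \<ge> a} < c"
  shows "\<forall>\<^sub>F n in sequentially.
    outer_measure_of (M n) {x \<in> space (M n). \<psi> (Y n x) \<ge> b} \<le> ennreal c"
proof -
  interpret prob_space N by fact
  \<comment> \<open>\<open>h\<close> climbs linearly from \<open>0\<close> at level \<open>a\<close> of \<open>\<psi>\<close> to \<open>1\<close> at level \<open>b\<close>.\<close>
  define h where "h y = max 0 (min 1 ((\<psi> y - a) / (b - a)))" for y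
  have h: "0 \<le> h y" "h y \<le> 1" for y by (auto simp: h_def)
  have h1: "h y = 1" if "b \<le> \<psi> y" for y using that ab by (simp add: h_def field_simps)
  have h0: "h y = 0" if "\<psi> y < a" for y using that ab by (simp add: h_def field_simps max_def)
  have ch: "continuous_on UNIV h"
    unfolding h_def using \<psi> by (intro continuous_intros) (use ab in auto)
  have Z[measurable]: "Z \<in> borel_measurable N" using W by (simp add: HJ_weak_conv_def)
  have [measurable]: "\<psi> \<in> borel_measurable borel" "h \<in> borel_measurable borel"
    using \<psi> ch by (auto intro: borel_measurable_continuous_onI)
  have "(\<lambda>n. outer_expectation (M n) (\<lambda>x. h (Y n x))) \<longlonglongrightarrow> (\<integral>w. h (Z w) \<partial>N)"
    using W ch h unfolding HJ_weak_conv_def by (auto simp: bounded_iff intro!: exI[of _ 1])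
  moreover have "(\<integral>w. h (Z w) \<partial>N) < c"
  proof -
    have "(\<integral>w. h (Z w) \<partial>N) \<le> (\<integral>w. indicator {w \<in> space N. \<psi> (Z w) \<ge> a} w \<partial>N)"
      using h h0 by (intro integral_mono integrable_const_bound[where B=1])
        (auto simp: indicator_def not_le)
    also have "\<dots> = measure N {w \<in> space N. \<psi> (Z w) \<ge> a}"
      by (subst Bochner_Integration.integral_indicator) (auto intro!: arg_cong[of _ _ "measure N"])
    finally show ?thesis using c by simp
  qed
  ultimately have "\<forall>\<^sub>F n in sequentially. outer_expectation (M n) (\<lambda>x. h (Y n x)) < c"
    by (rule order_tendstoD)
  with M show ?thesis
  proof eventually_elim
    case (elim n)
    have "outer_measure_of (M n) {x \<in> space (M n). \<psi> (Y n x) \<ge> b}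
      \<le> ennreal (outer_expectation (M n) (\<lambda>x. h (Y n x)))"
      by (rule outer_measure_of_le_outer_expectation[where b=1]) (use elim h h1 in auto)
    also have "\<dots> \<le> ennreal c" using elim by (intro ennreal_leI) simp
    finally show ?case .
  qed
qed

lemma prob_tail_less:
  fixes T :: "'w \<Rightarrow> real"
  assumes "prob_space N" and T: "T \<in> borel_measurable N" and e: "0 < (e::real)"
  shows "\<exists>c>0. measure N {w \<in> space N. T w \<ge> c} < e"
proof -
  interpret prob_space N by fact
  interpret D: real_distribution "distr N borel T" using T by simp
  have "\<forall>\<^sub>F x in at_top. cdf (distr N borel T) x > 1 - e"
    using D.cdf_lim_at_top_prob e by (intro order_tendstoD) auto
  then obtain x where x: "\<And>y. y \<ge> x \<Longrightarrow> cdf (distr N borel T) y > 1 - e"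
    by (auto simp: eventually_at_top_linorder)
  define y where "y = max x 1"
  have S: "T -` {..y} \<inter> space N \<in> sets N" using T by measurable
  have "measure N {w \<in> space N. T w \<ge> y + 1} \<le> measure N (space N - (T -` {..y} \<inter> space N))"
    using T by (intro finite_measure_mono) auto
  also have "\<dots> = 1 - measure N (T -` {..y} \<inter> space N)"
    by (rule prob_compl[OF S])
  also have "measure N (T -` {..y} \<inter> space N) = cdf (distr N borel T) y"
    using T by (simp add: cdf_def measure_distr)
  also have "1 - cdf (distr N borel T) y < e" using x[of y] unfolding y_def by simp
  finally have "measure N {w \<in> space N. T w \<ge> y + 1} < e" .
  moreover have "y + 1 > 0" by (simp add: y_def)
  ultimately show ?thesis by blast
qed

lemma HJ_weak_conv_asymptotically_tight:
  fixes \<psi> :: "'m::metric_space \<Rightarrow> real"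
  assumes W: "HJ_weak_conv M Y N Z" and N: "prob_space N"
    and M: "\<forall>\<^sub>F n in sequentially. prob_space (M n)"
    and \<psi>: "continuous_on UNIV \<psi>" and e: "0 < e"
  shows "\<exists>c>0. \<forall>\<^sub>F n in sequentially.
    outer_measure_of (M n) {x \<in> space (M n). \<psi> (Y n x) \<ge> c} \<le> ennreal e"
proof -
  have [measurable]: "\<psi> \<in> borel_measurable borel" "Z \<in> borel_measurable N"
    using \<psi> W by (auto simp: HJ_weak_conv_def intro: borel_measurable_continuous_onI)
  obtain c where c: "c > 0" "measure N {w \<in> space N. \<psi> (Z w) \<ge> c} < e"
    using prob_tail_less[OF N _ e, of "\<lambda>w. \<psi> (Z w)"] by auto
  show ?thesis
    using HJ_weak_conv_outer_measure_ge[OF W N M \<psi>, of c "c + 1" e] c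
    by (intro exI[of _ "c + 1"]) auto
qed

section \<open>Strict differentiability\<close>

text \<open>In a Euclidean space the unit sphere is compact. A sequence of points along which the Frechet
  remainder is too large therefore has a subsequence with convergent directions, and along it
  Hadamard differentiability is violated.\<close>

lemma hadamard_derivative_imp_has_derivative:
  fixes f :: "'a::euclidean_space \<Rightarrow> 'e::real_normed_vector"
  assumes H: "hadamard_derivative_at f f' a S" and S: "open S" "a \<in> S"
  shows "(f has_derivative blinfun_apply f') (at a)"
proof (rule ccontr)
  assume "\<not> ?thesis"
  then obtain e where e: "e > 0"
    and bad: "\<And>d. d > 0 \<Longrightarrow> \<exists>y. norm (y - a) < d \<and> norm (f y - f a - f' (y - a)) > e * norm (y - a)"
    unfolding has_derivative_at_alt by (auto simp: not_le blinfun.bounded_linear_right)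
  obtain r where r: "r > 0" "ball a r \<subseteq> S" using S openE by blast
  have "\<exists>y. norm (y - a) < min r (1 / real (Suc n)) \<and> norm (f y - f a - f' (y - a)) > e * norm (y - a)" for n
    using r by (intro bad) auto
  then obtain y where y: "\<And>n. norm (y n - a) < min r (1 / real (Suc n))"
    "\<And>n. norm (f (y n) - f a - f' (y n - a)) > e * norm (y n - a)" by metis
  \<comment> \<open>Polar coordinates around \<open>a\<close>: step lengths \<open>t n\<close> and directions \<open>h n\<close>.\<close>
  define t where "t n = norm (y n - a)" for n
  define h where "h n = (y n - a) /\<^sub>R t n" for n
  have ne: "y n \<noteq> a" for n using y(2)[of n] by (auto simp: blinfun.zero_right)
  hence t0: "t n \<noteq> 0" "t n > 0" for n by (auto simp: t_def)
  have th: "t n *\<^sub>R h n = y n - a" for n using t0 by (simp add: h_def)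
  have "norm (h n) = 1" for n using t0[of n] by (simp add: h_def t_def[symmetric])
  hence "h n \<in> sphere 0 1" for n by simp
  then obtain l k where lk: "strict_mono (k :: nat \<Rightarrow> nat)" "(h \<circ> k) \<longlonglongrightarrow> l"
    using compact_imp_seq_compact[OF compact_sphere] unfolding seq_compact_def by metis
  have "t \<longlonglongrightarrow> 0"
    by (rule Lim_null_comparison[OF _ LIMSEQ_Suc[OF lim_1_over_n]])
      (use y(1) in \<open>auto simp: t_def less_imp_le intro!: eventuallyI\<close>)
  hence tk: "(t \<circ> k) \<longlonglongrightarrow> 0" using lk LIMSEQ_subseq_LIMSEQ by blast
  have inS: "a + t n *\<^sub>R h n \<in> S" for n
    using r(2) y(1)[of n] by (auto simp: th dist_norm norm_minus_commute)
  have "(\<lambda>n. (f (a + t (k n) *\<^sub>R h (k n)) - f a) /\<^sub>R t (k n)) \<longlonglongrightarrow> f' l"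
    using H[unfolded hadamard_derivative_at_def, rule_format, of "t \<circ> k" "h \<circ> k" l] tk lk t0 inS
    by simp
  moreover have "(\<lambda>n. f' (h (k n))) \<longlonglongrightarrow> f' l"
    using lk by (intro blinfun.tendsto) (auto simp: o_def)
  ultimately have "(\<lambda>n. norm ((f (a + t (k n) *\<^sub>R h (k n)) - f a) /\<^sub>R t (k n) - f' (h (k n)))) \<longlonglongrightarrow> norm (f' l - f' l)"
    by (intro tendsto_norm tendsto_diff)
  moreover have "norm ((f (a + t n *\<^sub>R h n) - f a) /\<^sub>R t n - f' (h n)) \<ge> e" for n
  proof -
    have eq: "(f (a + t n *\<^sub>R h n) - f a) /\<^sub>R t n - f' (h n) = (f (y n) - f a - f' (y n - a)) /\<^sub>R t n"
      unfolding th unfolding h_def blinfun.scaleR_right scaleR_diff_right[symmetric] by simp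
    have "norm ((f (y n) - f a - f' (y n - a)) /\<^sub>R t n) = norm (f (y n) - f a - f' (y n - a)) / t n"
      using t0[of n] by (simp add: divide_inverse_commute)
    moreover have "e \<le> norm (f (y n) - f a - f' (y n - a)) / t n"
      using y(2)[of n] t0(2)[of n] by (simp add: pos_le_divide_eq t_def less_imp_le)
    ultimately show ?thesis unfolding eq by simp
  qed
  ultimately have "e \<le> norm (f' l - f' l)"
    by (intro LIMSEQ_le_const) auto
  with e show False by simp
qed

text \<open>The mean value inequality for \<open>f - f' a\<close>, whose derivative is small near \<open>a\<close> by continuity of \<open>f'\<close>.
  Strict differentiability lets both end points of an increment move, as is needed when the
  parameter that generates the data varies with the sample size.\<close>

lemma continuously_hadamard_imp_strict_derivative:
  fixes f :: "'a::euclidean_space \<Rightarrow> 'e::real_normed_vector"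
  assumes f: "continuously_hadamard_differentiable f f' S" and S: "open S" "a \<in> S" and e: "0 < e"
  shows "\<exists>d>0. \<forall>x\<in>ball a d. \<forall>y\<in>ball a d. norm (f y - f x - f' a (y - x)) \<le> e * norm (y - x)"
proof -
  obtain r where r: "r > 0" "ball a r \<subseteq> S" using S openE by blast
  have "continuous_on S f'" and had: "\<And>x. x \<in> S \<Longrightarrow> hadamard_derivative_at f (f' x) x S"
    using f unfolding continuously_hadamard_differentiable_def by blast+
  hence "isCont f' a"
    using S by (simp add: continuous_on_eq_continuous_at)
  then obtain s where s: "s > 0" "\<And>x. dist x a < s \<Longrightarrow> dist (f' x) (f' a) < e"
    using e unfolding continuous_at_eps_delta by metis
  define d where "d = min r s"
  have d: "d > 0" "ball a d \<subseteq> S" using r s by (auto simp: d_def)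
  have der: "(f has_derivative blinfun_apply (f' x)) (at x within ball a d)" if "x \<in> ball a d" for x
    using that d S had[of x]
    by (intro has_derivative_at_withinI[OF hadamard_derivative_imp_has_derivative[of _ _ _ S]]) auto
  have on: "onorm (blinfun_apply (f' x) - blinfun_apply (f' a)) \<le> e" if "x \<in> ball a d" for x
    using s(2)[of x] that
    by (simp add: d_def dist_norm norm_blinfun.rep_eq minus_blinfun.rep_eq fun_diff_def norm_minus_commute)
  show ?thesis
  proof (intro exI[of _ d] conjI ballI)
    fix x y assume xy: "x \<in> ball a d" "y \<in> ball a d"
    have "x + t *\<^sub>R (y - x) \<in> ball a d" if "t \<in> {0..1}" for t
      using convexD_alt[OF convex_ball xy, of t] that by (simp add: algebra_simps)
    moreover have "a \<in> ball a d" using d by simp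
    ultimately have "norm (f y - f x - f' a (y - x)) \<le> norm (y - x) * e"
      using differentiable_bound_linearization[of x y "ball a d" f "\<lambda>x. blinfun_apply (f' x)" a e]
        der on by blast
    then show "norm (f y - f x - f' a (y - x)) \<le> e * norm (y - x)"
      by (simp add: mult.commute)
  qed (use d in auto)
qed

section \<open>The weak law of large numbers\<close>

lemma indep_vars_coordinates:
  fixes n :: nat
  assumes H: "prob_space H" and n: "1 \<le> n"
  shows "prob_space.indep_vars (\<Pi>\<^sub>M i\<in>{..<n}. H) (\<lambda>_. H) (\<lambda>i x. x i) {..<n}"
proof -
  interpret P: prob_space "\<Pi>\<^sub>M i\<in>{..<n}. H" by (intro prob_space_PiM H)
  have "distr (\<Pi>\<^sub>M i\<in>{..<n}. H) (\<Pi>\<^sub>M i\<in>{..<n}. H) (\<lambda>x. restrict x {..<n})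
      = distr (\<Pi>\<^sub>M i\<in>{..<n}. H) (\<Pi>\<^sub>M i\<in>{..<n}. H) (\<lambda>x. x)"
    by (intro distr_cong) (auto simp: space_PiM)
  also have "\<dots> = (\<Pi>\<^sub>M i\<in>{..<n}. H)" by (rule distr_id)
  also have "\<dots> = (\<Pi>\<^sub>M i\<in>{..<n}. distr (\<Pi>\<^sub>M i\<in>{..<n}. H) H (\<lambda>x. x i))"
    by (intro PiM_cong refl distr_PiM_component[symmetric] H)
  moreover have "{..<n} \<noteq> {}" using n lessThan_iff[of 0 n] by fastforce
  ultimately show ?thesis
    by (subst P.indep_vars_iff_distr_eq_PiM') auto
qed

lemma weak_law_bounded:
  fixes f :: "'x \<Rightarrow> real"
  assumes H: "prob_space H" and f: "f \<in> borel_measurable H" and b: "\<And>y. \<bar>f y\<bar> \<le> b"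
    and r: "0 < r" and e: "0 < e"
  shows "\<forall>\<^sub>F n in sequentially. measure (\<Pi>\<^sub>M i\<in>{..<n}. H)
    {x \<in> space (\<Pi>\<^sub>M i\<in>{..<n}. H). r \<le> \<bar>(\<Sum>i<n. f (x i)) / real n - (\<integral>y. f y \<partial>H)\<bar>} \<le> e"
proof -
  \<comment> \<open>Hoeffding's inequality asks for a non-degenerate interval, and \<open>b\<close> may be \<open>0\<close>.\<close>
  define B where "B = b + 1"
  have B: "B > 0" "\<And>y. \<bar>f y\<bar> \<le> B" using b[of undefined] order_trans[OF b, of B] by (auto simp: B_def)
  have "(\<lambda>n. 2 * exp (-2 * real n * r\<^sup>2 / (B - - B)\<^sup>2)) \<longlonglongrightarrow> 0"
  proof -
    have "filterlim (\<lambda>n. real n * (2 * r\<^sup>2 / (B - - B)\<^sup>2)) at_top sequentially"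
      using r B by (intro filterlim_at_top_mult_tendsto_pos[OF tendsto_const _ filterlim_real_sequentially]) auto
    hence "((\<lambda>n. exp (- (real n * (2 * r\<^sup>2 / (B - - B)\<^sup>2)))) \<longlongrightarrow> 0) sequentially"
      by (intro filterlim_compose[OF exp_at_bot] filterlim_compose[OF filterlim_uminus_at_bot_at_top])
    from tendsto_mult[OF tendsto_const[of 2] this] show ?thesis by (simp add: mult_ac)
  qed
  hence "\<forall>\<^sub>F n in sequentially. 2 * exp (-2 * real n * r\<^sup>2 / (B - - B)\<^sup>2) < e"
    using e by (intro order_tendstoD) auto
  then show ?thesis using eventually_ge_at_top[of 1]
  proof eventually_elim
    case (elim n)
    let ?P = "\<Pi>\<^sub>M i\<in>{..<n}. H"
    interpret P: prob_space ?P by (intro prob_space_PiM H)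
    have coord: "distr ?P H (\<lambda>x. x i) = H" if "i < n" for i
      using that by (intro distr_PiM_component H) auto
    have fi[measurable]: "(\<lambda>x. f (x i)) \<in> borel_measurable ?P" if "i < n" for i
      using that by (intro measurable_compose[OF _ f] measurable_component_singleton) auto
    have law: "distr ?P borel (\<lambda>x. f (x i)) = distr H borel f" if "i < n" for i
      using that f coord[OF that] distr_distr[of f H borel "\<lambda>x. x i" ?P] by (simp add: comp_def)
    have n0: "0 < n" using elim by simp
    have "integral\<^sup>L (distr ?P H (\<lambda>x. x 0)) f = P.expectation (\<lambda>x. f (x 0))"
      using n0 f by (intro integral_distr) auto
    hence mean: "P.expectation (\<lambda>x. f (x 0)) = (\<integral>y. f y \<partial>H)" by (simp only: coord[OF n0])
    interpret iid: Hoeffding_ineq_iid ?P "{..<n}" "\<lambda>i x. f (x i)" "\<lambda>x. f (x 0)" "- B" B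
        "P.expectation (\<lambda>x. f (x 0))"
    proof unfold_locales
      show "P.indep_vars (\<lambda>_. borel) (\<lambda>i x. f (x i)) {..<n}"
        using f elim by (intro P.indep_vars_compose2[OF indep_vars_coordinates[OF H]]) auto
      show "distr ?P borel (\<lambda>x. f (x i)) = distr ?P borel (\<lambda>x. f (x 0))" if "i \<in> {..<n}" for i
        using law[of i] law[of 0] that n0 by simp
      show "(\<lambda>x. f (x 0)) \<in> borel_measurable ?P" by (rule fi[OF n0])
      have "- B \<le> f y \<and> f y \<le> B" for y using B(2)[of y] by linarith
      thus "AE x in ?P. f (x 0) \<in> {- B..B}" by (intro AE_I2) simp
    qed auto
    have "{..<n} \<noteq> {}" using n0 lessThan_iff[of 0 n] by fastforce
    from iid.Hoeffding_ineq_abs_ge'[OF _ _ this, of r] r B(1) elim(1) show ?case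
      by (simp add: mean)
  qed
qed

text \<open>\<open>f\<close> is truncated at a level beyond which it has little mass: the truncated part obeys
  Hoeffding's inequality and the rest is small on average, hence small with high probability by
  Markov's inequality.\<close>

lemma weak_law_of_large_numbers:
  fixes f :: "'x \<Rightarrow> real"
  assumes H: "prob_space H" and f: "integrable H f" and r: "0 < r" and e: "0 < e"
  shows "\<forall>\<^sub>F n in sequentially. measure (\<Pi>\<^sub>M i\<in>{..<n}. H)
    {x \<in> space (\<Pi>\<^sub>M i\<in>{..<n}. H). r \<le> \<bar>(\<Sum>i<n. f (x i)) / real n - (\<integral>y. f y \<partial>H)\<bar>} \<le> e"
proof -
  have fm[measurable]: "f \<in> borel_measurable H" using f by auto
  define g where "g k y = max (- real k) (min (real k) (f y))" for k y
  have gm[measurable]: "g k \<in> borel_measurable H" for k unfolding g_def by measurable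
  have "(\<lambda>k. \<integral>y. \<bar>f y - g k y\<bar> \<partial>H) \<longlonglongrightarrow> (\<integral>y. 0 \<partial>H)"
  proof (rule integral_dominated_convergence[where w = "\<lambda>y. \<bar>f y\<bar>"])
    show "AE y in H. (\<lambda>k. \<bar>f y - g k y\<bar>) \<longlonglongrightarrow> 0"
    proof (intro AE_I2 tendsto_eventually)
      fix y
      obtain k0 where "\<bar>f y\<bar> \<le> real k0" using real_arch_simple by blast
      thus "\<forall>\<^sub>F k in sequentially. \<bar>f y - g k y\<bar> = 0"
        by (intro eventually_sequentiallyI[of k0]) (auto simp: g_def)
    qed
    show "AE y in H. norm \<bar>f y - g k y\<bar> \<le> \<bar>f y\<bar>" for k by (intro AE_I2) (auto simp: g_def)
  qed (use f in auto)
  hence "\<forall>\<^sub>F k in sequentially. (\<integral>y. \<bar>f y - g k y\<bar> \<partial>H) < min (r / 3) (e * r / 6)"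
    using r e by (intro order_tendstoD) auto
  then obtain k where k: "(\<integral>y. \<bar>f y - g k y\<bar> \<partial>H) < r / 3" "(\<integral>y. \<bar>f y - g k y\<bar> \<partial>H) < e * r / 6"
    by (auto simp: eventually_sequentially)
  have gb: "\<bar>g k y\<bar> \<le> real k" for y by (auto simp: g_def)
  define d where "d y = \<bar>f y - g k y\<bar>" for y
  have gi: "integrable H (g k)"
    using f by (rule Bochner_Integration.integrable_bound) (auto simp: g_def)
  hence di: "integrable H d" unfolding d_def using f by auto
  have "\<forall>\<^sub>F n in sequentially. measure (\<Pi>\<^sub>M i\<in>{..<n}. H)
    {x \<in> space (\<Pi>\<^sub>M i\<in>{..<n}. H). r/3 \<le> \<bar>(\<Sum>i<n. g k (x i)) / real n - (\<integral>y. g k y \<partial>H)\<bar>} \<le> e/2"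
    using r e by (intro weak_law_bounded[where b = "real k"] H gm gb) auto
  then show ?thesis using eventually_ge_at_top[of 1]
  proof eventually_elim
    case (elim n)
    let ?P = "\<Pi>\<^sub>M i\<in>{..<n}. H"
    interpret P: prob_space ?P by (intro prob_space_PiM H)
    have n0: "0 < n" using elim by simp
    have coord: "distr ?P H (\<lambda>x. x i) = H" if "i < n" for i
      using that by (intro distr_PiM_component H) auto
    have dint: "integrable ?P (\<lambda>x. d (x i)) \<and> (\<integral>x. d (x i) \<partial>?P) = (\<integral>y. d y \<partial>H)" if "i < n" for i
      using that di coord[OF that] integrable_distr_eq[of "\<lambda>x. x i" ?P H d]
        integral_distr[of "\<lambda>x. x i" ?P H d] by auto
    have ai: "integrable ?P (\<lambda>x. (\<Sum>i<n. d (x i)) / real n)" by (intro integrable_divide_zero Bochner_Integration.integrable_sum) (use dint in auto)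
    have "(\<integral>x. (\<Sum>i<n. d (x i)) / real n \<partial>?P) = (\<integral>y. d y \<partial>H)"
      using dint n0 by (simp add: Bochner_Integration.integral_sum)
    moreover have "P.prob {x \<in> space ?P. r/3 \<le> (\<Sum>i<n. d (x i)) / real n}
        \<le> (\<integral>x. (\<Sum>i<n. d (x i)) / real n \<partial>?P) / (r/3)"
      using ai r by (intro integral_Markov_inequality_measure[where A = "{}"])
        (auto intro!: AE_I2 divide_nonneg_nonneg sum_nonneg simp: d_def)
    moreover have "(\<integral>y. d y \<partial>H) / (r/3) \<le> e/2"
      using k(2) r unfolding d_def by (simp add: field_simps)
    ultimately have small: "P.prob {x \<in> space ?P. r/3 \<le> (\<Sum>i<n. d (x i)) / real n} \<le> e/2" by simp
    let ?A = "{x \<in> space ?P. r/3 \<le> \<bar>(\<Sum>i<n. g k (x i)) / real n - (\<integral>y. g k y \<partial>H)\<bar>}"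
    let ?B = "{x \<in> space ?P. r/3 \<le> (\<Sum>i<n. d (x i)) / real n}"
    have sub: "{x \<in> space ?P. r \<le> \<bar>(\<Sum>i<n. f (x i)) / real n - (\<integral>y. f y \<partial>H)\<bar>} \<subseteq> ?A \<union> ?B"
    proof (intro subsetI, rule ccontr)
      fix x assume "x \<in> {x \<in> space ?P. r \<le> \<bar>(\<Sum>i<n. f (x i)) / real n - (\<integral>y. f y \<partial>H)\<bar>}"
        and "x \<notin> ?A \<union> ?B"
      hence x: "r \<le> \<bar>(\<Sum>i<n. f (x i)) / real n - (\<integral>y. f y \<partial>H)\<bar>"
        and nd: "(\<Sum>i<n. d (x i)) / real n < r / 3"
        and 3: "\<bar>(\<Sum>i<n. g k (x i)) / real n - (\<integral>y. g k y \<partial>H)\<bar> < r / 3"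
        by (auto simp: not_le)
      have "\<bar>(\<Sum>i<n. f (x i)) / real n - (\<Sum>i<n. g k (x i)) / real n\<bar> = \<bar>\<Sum>i<n. f (x i) - g k (x i)\<bar> / real n"
        by (simp add: sum_subtractf diff_divide_distrib[symmetric])
      also have "\<dots> \<le> (\<Sum>i<n. d (x i)) / real n"
        unfolding d_def by (intro divide_right_mono sum_abs) auto
      finally have 1: "\<bar>(\<Sum>i<n. f (x i)) / real n - (\<Sum>i<n. g k (x i)) / real n\<bar> < r/3" using nd by (rule le_less_trans)
      have "\<bar>(\<integral>y. f y \<partial>H) - (\<integral>y. g k y \<partial>H)\<bar> = \<bar>\<integral>y. f y - g k y \<partial>H\<bar>"
        using f gi by simp
      also have "\<dots> \<le> (\<integral>y. \<bar>f y - g k y\<bar> \<partial>H)" by (rule integral_abs_bound)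
      finally have 2: "\<bar>(\<integral>y. f y \<partial>H) - (\<integral>y. g k y \<partial>H)\<bar> < r/3" using k by simp
      show False using x 1 2 3 by linarith
    qed
    have meas: "(\<lambda>x. \<Sum>i<n. h (x i)) \<in> borel_measurable ?P" if "h \<in> borel_measurable H" for h :: "'x \<Rightarrow> real"
      using that by measurable
    have [measurable]: "(\<lambda>x. \<Sum>i<n. f (x i)) \<in> borel_measurable ?P" "(\<lambda>x. \<Sum>i<n. g k (x i)) \<in> borel_measurable ?P"
      "(\<lambda>x. \<Sum>i<n. d (x i)) \<in> borel_measurable ?P"
      using di by (auto intro!: meas)
    have "P.prob {x \<in> space ?P. r \<le> \<bar>(\<Sum>i<n. f (x i)) / real n - (\<integral>y. f y \<partial>H)\<bar>} \<le> P.prob (?A \<union> ?B)"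
      by (intro P.finite_measure_mono sub) measurable
    also have "\<dots> \<le> P.prob ?A + P.prob ?B" by (intro measure_Un_le) measurable
    finally show ?case using small elim by linarith
  qed
qed

section \<open>Quantiles that are not atoms\<close>

text \<open>Let \<open>q\<close> be the left end point of the interval of \<open>p\<close>-quantiles. All points left of \<open>q\<close> have
  distribution function below \<open>p\<close>, and as \<open>q\<close> is no atom, the distribution function approaches \<open>p\<close>
  there. The interval from \<open>a\<close> to \<open>b\<close>, placed just left of \<open>q\<close>, leaves room for strict inequalities.\<close>

lemma quantile_approach_from_below:
  assumes "real_distribution F" and p: "0 < p" "p < 1" and e: "0 < e"
    and no_atom: "\<And>q. is_quantile F p q \<Longrightarrow> measure F {q} = 0"
  shows "\<exists>a b. a < b \<and> measure F {..b} < p \<and> measure F {a..} < 1 - p + e"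
proof -
  interpret real_distribution F by fact
  define S where "S = {t. p \<le> cdf F t}"
  have "\<forall>\<^sub>F t in at_top. p < cdf F t" using cdf_lim_at_top_prob p by (intro order_tendstoD) auto
  then obtain t1 where "p < cdf F t1" by (auto simp: eventually_at_top_linorder)
  hence ne: "S \<noteq> {}" unfolding S_def using less_imp_le by blast
  have "\<forall>\<^sub>F t in at_bot. cdf F t < p" using cdf_lim_at_bot p by (intro order_tendstoD) auto
  then obtain t0 where t0: "\<And>t. t \<le> t0 \<Longrightarrow> cdf F t < p" by (auto simp: eventually_at_bot_linorder)
  have bdd: "bdd_below S"
  proof (rule bdd_belowI[of _ t0])
    show "t0 \<le> t" if "t \<in> S" for t using t0[of t] that by (cases "t \<le> t0") (auto simp: S_def)
  qed
  define q where "q = Inf S"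
  have below: "cdf F t < p" if "t < q" for t
    using that cInf_lower[OF _ bdd, of t] unfolding q_def S_def by (auto simp flip: not_le)
  have above: "p \<le> cdf F t" if t: "q < t" for t
  proof -
    obtain s where "s \<in> S" "s < t" using cInf_lessD[OF ne, of t] t unfolding q_def by blast
    thus ?thesis using cdf_nondecreasing[of s t] by (simp add: S_def)
  qed
  have "p \<le> cdf F q"
    using above by (intro tendsto_lowerbound[OF cdf_is_right_cont[of q, unfolded continuous_within]])
      (auto intro!: always_eventually simp: eventually_at_filter)
  moreover have "measure F {..<q} \<le> p"
    using below by (intro tendsto_upperbound[OF cdf_at_left])
      (auto intro!: always_eventually less_imp_le simp: eventually_at_filter)
  ultimately have "is_quantile F p q" by (simp add: is_quantile_def cdf_def)
  hence "isCont (cdf F) q" by (simp add: isCont_cdf no_atom)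
  hence "(cdf F \<longlongrightarrow> cdf F q) (at_left q)"
    unfolding isCont_def by (rule filterlim_at_split[THEN iffD1, THEN conjunct1])
  hence "\<forall>\<^sub>F t in at_left q. p - e < cdf F t"
    using \<open>p \<le> cdf F q\<close> e by (intro order_tendstoD(1)) auto
  then obtain c where c: "c < q" "p - e < cdf F c"
    unfolding eventually_at_left_field by (metis dense)
  define a b where "a = (2 * c + q) / 3" and "b = (c + 2 * q) / 3"
  have ab: "c < a" "a < b" "b < q" using c by (auto simp: a_def b_def)
  have "measure F {a..} \<le> measure F (space F - {..c})"
    using ab by (intro finite_measure_mono) auto
  also have "\<dots> = 1 - cdf F c" by (subst prob_compl) (auto simp: cdf_def)
  finally show ?thesis
    using c below[OF ab(3)] ab by (intro exI[of _ a] exI[of _ b]) (auto simp: cdf_def)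
qed

text \<open>The mirror image, just right of the right end point of the interval of \<open>p\<close>-quantiles.\<close>

lemma quantile_approach_from_above:
  assumes "real_distribution F" and p: "0 < p" "p < 1" and e: "0 < e"
    and no_atom: "\<And>q. is_quantile F p q \<Longrightarrow> measure F {q} = 0"
  shows "\<exists>a b. a < b \<and> p < measure F {..<a} \<and> measure F {..b} < p + e"
proof -
  interpret real_distribution F by fact
  define S where "S = {t. cdf F t \<le> p}"
  have "\<forall>\<^sub>F t in at_top. p < cdf F t" using cdf_lim_at_top_prob p by (intro order_tendstoD) auto
  then obtain t1 where t1: "\<And>t. t1 \<le> t \<Longrightarrow> p < cdf F t" by (auto simp: eventually_at_top_linorder)
  have bdd: "bdd_above S"
  proof (rule bdd_aboveI[of _ t1])
    show "t \<le> t1" if "t \<in> S" for t using t1[of t] that by (cases "t1 \<le> t") (auto simp: S_def)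
  qed
  have "\<forall>\<^sub>F t in at_bot. cdf F t < p" using cdf_lim_at_bot p by (intro order_tendstoD) auto
  then obtain t0 where "cdf F t0 < p" by (auto simp: eventually_at_bot_linorder)
  hence ne: "S \<noteq> {}" unfolding S_def using less_imp_le by blast
  define q where "q = Sup S"
  have above: "p < cdf F t" if "q < t" for t
    using that cSup_upper[OF _ bdd, of t] unfolding q_def S_def by (auto simp flip: not_le)
  have below: "cdf F t \<le> p" if t: "t < q" for t
  proof -
    obtain s where "s \<in> S" "t < s" using less_cSupD[OF ne, of t] t unfolding q_def by blast
    thus ?thesis using cdf_nondecreasing[of t s] by (simp add: S_def)
  qed
  have "p \<le> cdf F q"
    using above by (intro tendsto_lowerbound[OF cdf_is_right_cont[of q, unfolded continuous_within]])
      (auto intro!: always_eventually less_imp_le simp: eventually_at_filter)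
  moreover have lq: "measure F {..<q} \<le> p"
    using below by (intro tendsto_upperbound[OF cdf_at_left])
      (auto intro!: always_eventually simp: eventually_at_filter)
  ultimately have "is_quantile F p q" by (simp add: is_quantile_def cdf_def)
  hence 0: "measure F {q} = 0" by (rule no_atom)
  have "cdf F q = measure F {..<q} + measure F {q}"
    unfolding cdf_def ivl_disj_un(2)[symmetric] by (intro finite_measure_Union) auto
  hence "cdf F q \<le> p" using lq 0 by simp
  hence "\<forall>\<^sub>F t in at_right q. cdf F t < p + e"
    using e by (intro order_tendstoD(2)[OF cdf_is_right_cont[of q, unfolded continuous_within]]) auto
  then obtain b where b: "q < b" "cdf F b < p + e"
    unfolding eventually_at_right_field by (metis dense)
  define a0 a where "a0 = (2 * q + b) / 3" and "a = (q + 2 * b) / 3"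
  have ab: "q < a0" "a0 < a" "a < b" using b by (auto simp: a_def a0_def)
  have "p < cdf F a0" by (rule above[OF ab(1)])
  also have "\<dots> \<le> measure F {..<a}" unfolding cdf_def using ab by (intro finite_measure_mono) auto
  finally show ?thesis using b ab by (intro exI[of _ a] exI[of _ b]) (auto simp: cdf_def)
qed

section \<open>Uniformity from sequential limits\<close>

text \<open>If the conclusion failed, each ball of radius \<open>1 / (k + 1)\<close> would contain a bad point for some
  index \<open>r k\<close>, with \<open>r\<close> strictly increasing. Filled up with \<open>l\<close> at the other indices, the bad points
  form a sequence that converges to \<open>l\<close>.\<close>

lemma eventually_ball_if_eventually_along_sequences:
  fixes l :: "'a::metric_space"
  assumes seq: "\<And>h. h \<longlonglongrightarrow> l \<Longrightarrow> \<forall>\<^sub>F n in sequentially. P n (h n)"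
  shows "\<exists>\<delta>>0. \<forall>\<^sub>F n in sequentially. \<forall>h\<in>ball l \<delta>. P n h"
proof (rule ccontr)
  assume neg: "\<not> ?thesis"
  have ex: "\<exists>n>m. \<exists>h\<in>ball l (1 / real (Suc k)). \<not> P n h" for m k
  proof -
    have "\<not> (\<forall>\<^sub>F n in sequentially. \<forall>h\<in>ball l (1 / real (Suc k)). P n h)"
      using neg by (meson of_nat_0_less_iff zero_less_Suc zero_less_divide_1_iff)
    thus ?thesis
      unfolding eventually_sequentially by (auto dest!: spec[of _ "Suc m"] simp: Suc_le_eq)
  qed
  obtain r where r: "\<And>k. \<exists>h\<in>ball l (1 / real (Suc k)). \<not> P (r k) h" "\<And>k. r k < r (Suc k)"
    using dependent_nat_choice[of "\<lambda>k n. \<exists>h\<in>ball l (1 / real (Suc k)). \<not> P n h" "\<lambda>k n n'. n < n'"] ex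
    by blast
  have sm: "strict_mono r" using r(2) by (simp add: strict_mono_Suc_iff)
  obtain g where g: "\<And>k. g k \<in> ball l (1 / real (Suc k))" "\<And>k. \<not> P (r k) (g k)"
    using r(1) by metis
  define h where "h n = (if n \<in> range r then g (inv r n) else l)" for n
  have hr: "h (r k) = g k" for k using strict_mono_imp_inj_on[OF sm] by (simp add: h_def)
  have "h \<longlonglongrightarrow> l"
  proof (rule metric_LIMSEQ_I)
    fix e :: real assume "0 < e"
    then obtain k0 where k0: "1 / real (Suc k0) < e" using nat_approx_posE by blast
    have "dist (h n) l < e" if n: "r k0 \<le> n" for n
    proof (cases "n \<in> range r")
      case True
      then obtain k where k: "n = r k" by auto
      hence "k0 \<le> k" using n sm by (simp add: strict_mono_less_eq)
      hence "1 / real (Suc k) \<le> 1 / real (Suc k0)" by (simp add: frac_le)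
      thus ?thesis using g(1)[of k] k0 by (simp add: k hr dist_commute)
    qed (use \<open>0 < e\<close> in \<open>simp add: h_def\<close>)
    thus "\<exists>N. \<forall>n\<ge>N. dist (h n) l < e" by blast
  qed
  from seq[OF this] obtain m where "\<And>n. m \<le> n \<Longrightarrow> P n (h n)" by (auto simp: eventually_sequentially)
  from this[of "r m"] show False using g(2)[of m] seq_suble[OF sm, of m] by (simp add: hr)
qed

lemma eventually_compact_if_eventually_along_sequences:
  fixes K :: "'a::metric_space set"
  assumes K: "compact K"
    and seq: "\<And>h l. l \<in> K \<Longrightarrow> h \<longlonglongrightarrow> l \<Longrightarrow> \<forall>\<^sub>F n in sequentially. P n (h n)"
  shows "\<forall>\<^sub>F n in sequentially. \<forall>h\<in>K. P n h"
proof -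
  have "\<forall>l\<in>K. \<exists>\<delta>>0. \<forall>\<^sub>F n in sequentially. \<forall>h\<in>ball l \<delta>. P n h"
    using seq by (intro ballI eventually_ball_if_eventually_along_sequences) auto
  then obtain \<delta> where \<delta>: "\<And>l. l \<in> K \<Longrightarrow> \<delta> l > 0"
    "\<And>l. l \<in> K \<Longrightarrow> \<forall>\<^sub>F n in sequentially. \<forall>h\<in>ball l (\<delta> l). P n h" by metis
  have "K \<subseteq> (\<Union>l\<in>K. ball l (\<delta> l))" using \<delta>(1) by force
  then obtain C where C: "C \<subseteq> K" "finite C" "K \<subseteq> (\<Union>l\<in>C. ball l (\<delta> l))"
    using compactE_image[OF K, of K "\<lambda>l. ball l (\<delta> l)"] by auto
  have "\<forall>\<^sub>F n in sequentially. \<forall>l\<in>C. \<forall>h\<in>ball l (\<delta> l). P n h"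
    using C \<delta>(2) by (intro eventually_ball_finite) auto
  thus ?thesis by eventually_elim (use C(3) in blast)
qed

section \<open>The statistic along converging parameters\<close>

text \<open>With \<open>u = \<surd>n (\<theta>est - \<theta>s)\<close>, the statistic is the norm of
  \<open>\<surd>n (\<bbbH>\<^sub>n - Hm \<theta>s) - \<surd>n (Hm \<theta>est - Hm \<theta>s)\<close>, read through the embedding, and strict
  differentiability replaces the second term by \<open>f' u\<close> with an error that is small compared with
  \<open>norm u\<close>. As \<open>u\<close> is asymptotically tight, the error is small in outer probability. The
  approximation is a fixed continuous function of the pair whose weak limit is assumed.\<close>

lemma gof_stat_linearization:
  fixes \<theta>\<^sub>0 :: "real^'d" and emb :: "'x measure \<Rightarrow> 'e::real_normed_vector"
    and f' :: "(real^'d) \<Rightarrow>\<^sub>L 'e"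
  assumes W: "joint_limit A emb \<theta>est (\<lambda>n. Hm (\<theta>s n)) \<theta>s N Z" and N: "prob_space N"
    and M: "\<forall>\<^sub>F n in sequentially. prob_space (\<Pi>\<^sub>M i\<in>{..<n}. Hm (\<theta>s n))"
    and \<theta>s: "\<theta>s \<longlonglongrightarrow> \<theta>\<^sub>0"
    and strict: "\<And>e. 0 < e \<Longrightarrow> \<exists>d>0. \<forall>s\<in>ball \<theta>\<^sub>0 d. \<forall>t\<in>ball \<theta>\<^sub>0 d.
      norm (emb (Hm t) - emb (Hm s) - f' (t - s)) \<le> e * norm (t - s)"
    and \<eta>: "0 < \<eta>" and \<epsilon>: "0 < \<epsilon>"
  defines "Y \<equiv> \<lambda>n x. sqrt (real n) *\<^sub>R (emb (empirical A n x) - emb (Hm (\<theta>s n)), \<theta>est n x - \<theta>s n)"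
  shows "\<forall>\<^sub>F n in sequentially. outer_measure_of (\<Pi>\<^sub>M i\<in>{..<n}. Hm (\<theta>s n))
    {x \<in> space (\<Pi>\<^sub>M i\<in>{..<n}. Hm (\<theta>s n)).
      \<eta> \<le> \<bar>gof_stat A emb Hm \<theta>est n x - norm (fst (Y n x) - f' (snd (Y n x)))\<bar>} \<le> ennreal \<epsilon>"
proof -
  have HJ: "HJ_weak_conv (\<lambda>n. \<Pi>\<^sub>M i\<in>{..<n}. Hm (\<theta>s n)) Y N Z"
    using W by (simp add: joint_limit_def Y_def)
  have "continuous_on UNIV (\<lambda>p::'e \<times> (real^'d). norm (snd p))" by (intro continuous_intros)
  from HJ_weak_conv_asymptotically_tight[OF HJ N M this \<epsilon>] obtain c where c: "c > 0"
    and tight: "\<forall>\<^sub>F n in sequentially. outer_measure_of (\<Pi>\<^sub>M i\<in>{..<n}. Hm (\<theta>s n))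
      {x \<in> space (\<Pi>\<^sub>M i\<in>{..<n}. Hm (\<theta>s n)). c \<le> norm (snd (Y n x))} \<le> ennreal \<epsilon>" by auto
  obtain d where d: "d > 0" and lin: "\<And>s t. s \<in> ball \<theta>\<^sub>0 d \<Longrightarrow> t \<in> ball \<theta>\<^sub>0 d \<Longrightarrow>
      norm (emb (Hm t) - emb (Hm s) - f' (t - s)) \<le> \<eta> / (2 * c) * norm (t - s)"
    using strict[of "\<eta> / (2 * c)"] \<eta> c by auto
  have "\<forall>\<^sub>F n in sequentially. dist (\<theta>s n) \<theta>\<^sub>0 < d / 2"
    using \<theta>s d by (intro tendstoD) auto
  moreover have "\<forall>\<^sub>F n in sequentially. 2 * c / d < sqrt (real n)"
    using filterlim_compose[OF sqrt_at_top filterlim_real_sequentially]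
    by (auto simp: filterlim_at_top_dense)
  ultimately show ?thesis using tight
  proof eventually_elim
    case (elim n)
    have sq: "sqrt (real n) > 0" using elim(2) c d by (meson divide_pos_pos less_trans mult_pos_pos zero_less_numeral)
    have "\<bar>gof_stat A emb Hm \<theta>est n x - norm (fst (Y n x) - f' (snd (Y n x)))\<bar> < \<eta>"
      if small: "norm (snd (Y n x)) < c" for x
    proof -
      let ?u = "\<theta>est n x - \<theta>s n"
      have u: "sqrt (real n) * norm ?u < c" using small sq by (simp add: Y_def)
      have "c < sqrt (real n) * (d / 2)" using elim(2) d by (simp add: field_simps)
      with u have "sqrt (real n) * norm ?u < sqrt (real n) * (d / 2)" by linarith
      hence "norm ?u < d / 2" using sq by (simp only: mult_less_cancel_left_pos)
      hence "dist (\<theta>est n x) (\<theta>s n) < d / 2" by (simp add: dist_norm)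
      hence "\<theta>est n x \<in> ball \<theta>\<^sub>0 d"
        using elim(1) dist_triangle[of "\<theta>est n x" \<theta>\<^sub>0 "\<theta>s n"] by (simp add: dist_commute)
      moreover have "\<theta>s n \<in> ball \<theta>\<^sub>0 d" using elim(1) d by (simp add: dist_commute)
      ultimately have l: "norm (emb (Hm (\<theta>est n x)) - emb (Hm (\<theta>s n)) - f' ?u) \<le> \<eta> / (2 * c) * norm ?u"
        by (intro lin)
      let ?v = "emb (empirical A n x) - emb (Hm (\<theta>est n x))"
      let ?w = "emb (empirical A n x) - emb (Hm (\<theta>s n)) - f' ?u"
      have "fst (Y n x) - f' (snd (Y n x)) = sqrt (real n) *\<^sub>R ?w"
        by (simp add: Y_def scaleR_diff_right flip: blinfun.scaleR_right)
      hence "\<bar>gof_stat A emb Hm \<theta>est n x - norm (fst (Y n x) - f' (snd (Y n x)))\<bar>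
          = sqrt (real n) * \<bar>norm ?v - norm ?w\<bar>"
        using sq by (simp add: gof_stat_def abs_mult flip: right_diff_distrib)
      also have "\<dots> \<le> sqrt (real n) * norm (?v - ?w)"
        using sq by (intro mult_left_mono norm_triangle_ineq3) auto
      also have "norm (?v - ?w) = norm (emb (Hm (\<theta>est n x)) - emb (Hm (\<theta>s n)) - f' ?u)"
        by (subst norm_minus_commute) (simp add: algebra_simps)
      also have "sqrt (real n) * \<dots> \<le> sqrt (real n) * (\<eta> / (2 * c) * norm ?u)"
        using sq l by (intro mult_left_mono) auto
      also have "\<dots> = \<eta> / (2 * c) * (sqrt (real n) * norm ?u)" by simp
      also have "\<dots> \<le> \<eta> / (2 * c) * c" using u c \<eta> by (intro mult_left_mono) auto
      also have "\<dots> < \<eta>" using c \<eta> by simp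
      finally show ?thesis .
    qed
    hence "outer_measure_of (\<Pi>\<^sub>M i\<in>{..<n}. Hm (\<theta>s n))
      {x \<in> space (\<Pi>\<^sub>M i\<in>{..<n}. Hm (\<theta>s n)).
      \<eta> \<le> \<bar>gof_stat A emb Hm \<theta>est n x - norm (fst (Y n x) - f' (snd (Y n x)))\<bar>}
      \<le> outer_measure_of (\<Pi>\<^sub>M i\<in>{..<n}. Hm (\<theta>s n))
      {x \<in> space (\<Pi>\<^sub>M i\<in>{..<n}. Hm (\<theta>s n)). c \<le> norm (snd (Y n x))}"
      by (intro outer_measure_of_mono) (auto simp: not_less[symmetric])
    with elim(3) show ?case by (rule order_trans[rotated])
  qed
qed

text \<open>The sign \<open>\<sigma>\<close> covers upper tails (\<open>\<sigma> = 1\<close>) and lower tails (\<open>\<sigma> = -1\<close>) at once. The gap between \<open>a\<close>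
  and \<open>b\<close> is shared between the portmanteau bound and the linearization error.\<close>

lemma gof_stat_signed_tail:
  fixes \<theta>\<^sub>0 :: "real^'d" and emb :: "'x measure \<Rightarrow> 'e::real_normed_vector"
    and f' :: "(real^'d) \<Rightarrow>\<^sub>L 'e" and \<sigma> :: real
  assumes W: "joint_limit A emb \<theta>est (\<lambda>n. Hm (\<theta>s n)) \<theta>s N Z" and N: "prob_space N"
    and M: "\<forall>\<^sub>F n in sequentially. prob_space (\<Pi>\<^sub>M i\<in>{..<n}. Hm (\<theta>s n))"
    and \<theta>s: "\<theta>s \<longlonglongrightarrow> \<theta>\<^sub>0"
    and strict: "\<And>e. 0 < e \<Longrightarrow> \<exists>d>0. \<forall>s\<in>ball \<theta>\<^sub>0 d. \<forall>t\<in>ball \<theta>\<^sub>0 d.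
      norm (emb (Hm t) - emb (Hm s) - f' (t - s)) \<le> e * norm (t - s)"
    and \<sigma>: "\<bar>\<sigma>\<bar> = 1" and ab: "a < b"
    and c: "measure N {w \<in> space N. a \<le> \<sigma> * norm (fst (Z w) - f' (snd (Z w)))} < c"
  shows "\<forall>\<^sub>F n in sequentially. outer_measure_of (\<Pi>\<^sub>M i\<in>{..<n}. Hm (\<theta>s n))
    {x \<in> space (\<Pi>\<^sub>M i\<in>{..<n}. Hm (\<theta>s n)). b \<le> \<sigma> * gof_stat A emb Hm \<theta>est n x} \<le> ennreal c"
proof -
  define Y where "Y = (\<lambda>n x. sqrt (real n) *\<^sub>R (emb (empirical A n x) - emb (Hm (\<theta>s n)), \<theta>est n x - \<theta>s n))"
  define \<psi> :: "'e \<times> (real^'d) \<Rightarrow> real" where "\<psi> p = \<sigma> * norm (fst p - f' (snd p))" for p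
  have HJ: "HJ_weak_conv (\<lambda>n. \<Pi>\<^sub>M i\<in>{..<n}. Hm (\<theta>s n)) Y N Z"
    using W by (simp add: joint_limit_def Y_def)
  have cont: "continuous_on UNIV \<psi>" unfolding \<psi>_def by (intro continuous_intros)
  define m where "m = (a + b) / 2"
  obtain c' where c': "measure N {w \<in> space N. a \<le> \<psi> (Z w)} < c'" "c' < c"
    using dense[OF c] unfolding \<psi>_def by auto
  have c'0: "0 < c'" using c'(1) measure_nonneg[of N] by (rule le_less_trans[rotated])
  have "\<forall>\<^sub>F n in sequentially. outer_measure_of (\<Pi>\<^sub>M i\<in>{..<n}. Hm (\<theta>s n))
    {x \<in> space (\<Pi>\<^sub>M i\<in>{..<n}. Hm (\<theta>s n)). m \<le> \<psi> (Y n x)} \<le> ennreal c'"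
    by (rule HJ_weak_conv_outer_measure_ge[OF HJ N M cont _ c'(1)]) (use ab in \<open>simp add: m_def\<close>)
  moreover have "\<forall>\<^sub>F n in sequentially. outer_measure_of (\<Pi>\<^sub>M i\<in>{..<n}. Hm (\<theta>s n))
    {x \<in> space (\<Pi>\<^sub>M i\<in>{..<n}. Hm (\<theta>s n)).
      b - m \<le> \<bar>gof_stat A emb Hm \<theta>est n x - norm (fst (Y n x) - f' (snd (Y n x)))\<bar>} \<le> ennreal (c - c')"
    unfolding Y_def by (rule gof_stat_linearization[OF W N M \<theta>s strict]) (use ab c' in \<open>auto simp: m_def\<close>)
  ultimately show ?thesis
  proof eventually_elim
    case (elim n)
    let ?P = "\<Pi>\<^sub>M i\<in>{..<n}. Hm (\<theta>s n)"
    let ?A = "{x \<in> space ?P. m \<le> \<psi> (Y n x)}"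
    let ?B = "{x \<in> space ?P. b - m \<le> \<bar>gof_stat A emb Hm \<theta>est n x - norm (fst (Y n x) - f' (snd (Y n x)))\<bar>}"
    have "outer_measure_of ?P {x \<in> space ?P. b \<le> \<sigma> * gof_stat A emb Hm \<theta>est n x}
        \<le> outer_measure_of ?P ?A + outer_measure_of ?P ?B"
    proof (rule outer_measure_of_subset_Un_le)
      have "m \<le> \<sigma> * v" if "b \<le> \<sigma> * u" "\<not> b - m \<le> \<bar>u - v\<bar>" for u v
        using \<sigma> that by (auto simp: abs_if split: if_splits)
      thus "{x \<in> space ?P. b \<le> \<sigma> * gof_stat A emb Hm \<theta>est n x} \<subseteq> ?A \<union> ?B"
        unfolding \<psi>_def by blast
    qed auto
    also have "\<dots> \<le> ennreal c' + ennreal (c - c')" using elim by (intro add_mono)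
    also have "\<dots> = ennreal c" using c' c'0 by (simp flip: ennreal_plus)
    finally show ?case .
  qed
qed

section \<open>Bootstrap quantiles\<close>

lemma bootstrap_sample_law:
  assumes boot: "bootstrap_sample A Q n R X" and Q: "prob_space Q" and n: "1 \<le> n"
    and x: "x \<in> space (\<Pi>\<^sub>M i\<in>{..<n}. A)"
  shows "X x \<in> Q \<rightarrow>\<^sub>M (\<Pi>\<^sub>M i\<in>{..<n}. A)"
    and "distr Q (\<Pi>\<^sub>M i\<in>{..<n}. A) (X x) = (\<Pi>\<^sub>M i\<in>{..<n}. R x)"
proof -
  interpret prob_space Q by fact
  have joint: "(\<lambda>(x, z). X x z) \<in> (\<Pi>\<^sub>M i\<in>{..<n}. A) \<Otimes>\<^sub>M Q \<rightarrow>\<^sub>M (\<Pi>\<^sub>M i\<in>{..<n}. A)"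
    and indep: "indep_vars (\<lambda>_. A) (\<lambda>i z. X x z i) {..<n}"
    and law: "\<And>i. i < n \<Longrightarrow> distr Q A (\<lambda>z. X x z i) = R x"
    using boot x by (auto simp: bootstrap_sample_def)
  show meas: "X x \<in> Q \<rightarrow>\<^sub>M (\<Pi>\<^sub>M i\<in>{..<n}. A)"
    using measurable_Pair2[OF joint x] by simp
  have "{..<n} \<noteq> {}" using n lessThan_iff[of 0 n] by fastforce
  have "distr Q (\<Pi>\<^sub>M i\<in>{..<n}. A) (X x)
      = distr Q (\<Pi>\<^sub>M i\<in>{..<n}. A) (\<lambda>z. \<lambda>i\<in>{..<n}. X x z i)"
  proof (rule distr_cong)
    fix z assume "z \<in> space Q"
    hence "X x z \<in> space (\<Pi>\<^sub>M i\<in>{..<n}. A)" using meas by (rule measurable_space[rotated])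
    thus "X x z = (\<lambda>i\<in>{..<n}. X x z i)" by (simp add: space_PiM PiE_restrict)
  qed auto
  also have "\<dots> = (\<Pi>\<^sub>M i\<in>{..<n}. distr Q A (\<lambda>z. X x z i))"
    using indep \<open>{..<n} \<noteq> {}\<close>
    by (subst indep_vars_iff_distr_eq_PiM'[symmetric]) (auto simp: indep_vars_def)
  also have "\<dots> = (\<Pi>\<^sub>M i\<in>{..<n}. R x)" by (intro PiM_cong) (auto simp: law)
  finally show "distr Q (\<Pi>\<^sub>M i\<in>{..<n}. A) (X x) = (\<Pi>\<^sub>M i\<in>{..<n}. R x)" .
qed

text \<open>The conclusion concerns the law of the resampled data alone. For the bootstrap it therefore
  depends on the observed sample only through the estimate, which makes it comparable with a limit
  theorem along a sequence of parameters.\<close>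

lemma quantile_le_imp_outer_measure_ge:
  fixes T :: "'y \<Rightarrow> real"
  assumes Q: "prob_space Q" and X: "X \<in> Q \<rightarrow>\<^sub>M P" and T: "(\<lambda>z. T (X z)) \<in> borel_measurable Q"
    and q: "is_quantile (distr Q borel (\<lambda>z. T (X z))) p \<xi>" and s: "\<xi> \<le> s"
  shows "ennreal p \<le> outer_measure_of (distr Q P X) {y \<in> space P. T y \<le> s}"
proof -
  interpret prob_space Q by fact
  have "p \<le> measure Q ((\<lambda>z. T (X z)) -` {..\<xi>} \<inter> space Q)"
    using q T by (simp add: is_quantile_def measure_distr)
  also have "\<dots> \<le> measure Q ((\<lambda>z. T (X z)) -` {..s} \<inter> space Q)"
    using T s by (intro finite_measure_mono) auto
  finally have "ennreal p \<le> emeasure Q ((\<lambda>z. T (X z)) -` {..s} \<inter> space Q)"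
    by (simp add: emeasure_eq_measure ennreal_leI)
  also have "\<dots> = outer_measure_of Q ((\<lambda>z. T (X z)) -` {..s} \<inter> space Q)"
    using T by (intro outer_measure_of_eq[symmetric] measurable_sets) auto
  also have "(\<lambda>z. T (X z)) -` {..s} \<inter> space Q = X -` {y \<in> space P. T y \<le> s} \<inter> space Q"
    using measurable_space[OF X] by auto
  also have "outer_measure_of Q \<dots> \<le> outer_measure_of (distr Q P X) {y \<in> space P. T y \<le> s}"
    using X by (intro outer_measure_of_vimage_le) auto
  finally show ?thesis .
qed

lemma quantile_ge_imp_outer_measure_ge:
  fixes T :: "'y \<Rightarrow> real"
  assumes Q: "prob_space Q" and X: "X \<in> Q \<rightarrow>\<^sub>M P" and T: "(\<lambda>z. T (X z)) \<in> borel_measurable Q"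
    and q: "is_quantile (distr Q borel (\<lambda>z. T (X z))) p \<xi>" and s: "s \<le> \<xi>"
  shows "ennreal (1 - p) \<le> outer_measure_of (distr Q P X) {y \<in> space P. s \<le> T y}"
proof -
  interpret prob_space Q by fact
  have "measure Q ((\<lambda>z. T (X z)) -` {..<\<xi>} \<inter> space Q) \<le> p"
    using q T by (simp add: is_quantile_def measure_distr)
  moreover have "measure Q (space Q - ((\<lambda>z. T (X z)) -` {..<\<xi>} \<inter> space Q))
      = 1 - measure Q ((\<lambda>z. T (X z)) -` {..<\<xi>} \<inter> space Q)"
    using T by (intro prob_compl measurable_sets) auto
  moreover have "measure Q (space Q - ((\<lambda>z. T (X z)) -` {..<\<xi>} \<inter> space Q))
      \<le> measure Q ((\<lambda>z. T (X z)) -` {s..} \<inter> space Q)"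
    using T s by (intro finite_measure_mono) auto
  ultimately have "1 - p \<le> measure Q ((\<lambda>z. T (X z)) -` {s..} \<inter> space Q)" by linarith
  hence "ennreal (1 - p) \<le> emeasure Q ((\<lambda>z. T (X z)) -` {s..} \<inter> space Q)"
    by (simp add: emeasure_eq_measure ennreal_leI)
  also have "\<dots> = outer_measure_of Q ((\<lambda>z. T (X z)) -` {s..} \<inter> space Q)"
    using T by (intro outer_measure_of_eq[symmetric] measurable_sets) auto
  also have "(\<lambda>z. T (X z)) -` {s..} \<inter> space Q = X -` {y \<in> space P. s \<le> T y} \<inter> space Q"
    using measurable_space[OF X] by auto
  also have "outer_measure_of Q \<dots> \<le> outer_measure_of (distr Q P X) {y \<in> space P. s \<le> T y}"
    using X by (intro outer_measure_of_vimage_le) auto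
  finally show ?thesis .
qed

section \<open>From deterministic to random parameters\<close>

text \<open>Given the sample \<open>x\<close>, the bootstrap draws from the model at \<open>\<theta>est n x\<close>. The property below
  reduces statements about this random parameter to deterministic sequences \<open>\<theta>s\<close>: if \<open>good n x\<close> holds
  for all large \<open>n\<close> whenever the estimates follow a sequence with the weak limit \<open>Z\<close>, then \<open>good\<close>
  holds with probability tending to one. It is the common consequence of the two alternative sets
  of conditions on the estimators.\<close>

definition sequences_control ::
    "'x measure \<Rightarrow> ('x measure \<Rightarrow> 'e::real_normed_vector) \<Rightarrow> (nat \<Rightarrow> (nat \<Rightarrow> 'x) \<Rightarrow> real^'d) \<Rightarrow>
     (real^'d \<Rightarrow> 'x measure) \<Rightarrow> 'x measure \<Rightarrow> real^'d \<Rightarrow> 'w measure \<Rightarrow> ('w \<Rightarrow> 'e \<times> (real^'d)) \<Rightarrow> bool" where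
  "sequences_control A emb \<theta>est Hm H \<theta>\<^sub>0 N Z \<longleftrightarrow>
     (\<forall>good.
        (\<forall>\<theta>s. \<theta>s \<longlonglongrightarrow> \<theta>\<^sub>0 \<and> joint_limit A emb \<theta>est (\<lambda>n. Hm (\<theta>s n)) \<theta>s N Z \<longrightarrow>
           (\<forall>\<^sub>F n in sequentially. \<forall>x\<in>space (\<Pi>\<^sub>M i\<in>{..<n}. A). \<theta>est n x = \<theta>s n \<longrightarrow> good n x)) \<longrightarrow>
        (\<forall>\<epsilon>>0. \<forall>\<^sub>F n in sequentially.
           outer_measure_of (\<Pi>\<^sub>M i\<in>{..<n}. H) {x \<in> space (\<Pi>\<^sub>M i\<in>{..<n}. H). \<not> good n x} \<le> ennreal \<epsilon>))"

lemma space_PiM_cong_sets: "sets H = sets A \<Longrightarrow> space (\<Pi>\<^sub>M i\<in>I. H) = space (\<Pi>\<^sub>M i\<in>I. A)"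
  using sets_eq_imp_space_eq[of H A] by (simp add: space_PiM)

lemma scaled_error_tight:
  fixes \<theta>\<^sub>0 :: "real^'d"
  assumes W: "joint_limit A emb \<theta>est (\<lambda>_. H) (\<lambda>_. \<theta>\<^sub>0) N Z" and N: "prob_space N" and H: "prob_space H"
    and \<epsilon>: "0 < \<epsilon>"
  shows "\<exists>c. \<forall>\<^sub>F n in sequentially. outer_measure_of (\<Pi>\<^sub>M i\<in>{..<n}. H)
    {x \<in> space (\<Pi>\<^sub>M i\<in>{..<n}. H). c \<le> norm (sqrt (real n) *\<^sub>R (\<theta>est n x - \<theta>\<^sub>0))} \<le> ennreal \<epsilon>"
proof -
  have "\<exists>c>0. \<forall>\<^sub>F n in sequentially. outer_measure_of (\<Pi>\<^sub>M i\<in>{..<n}. H)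
    {x \<in> space (\<Pi>\<^sub>M i\<in>{..<n}. H).
      c \<le> norm (snd (sqrt (real n) *\<^sub>R (emb (empirical A n x) - emb H, \<theta>est n x - \<theta>\<^sub>0)))} \<le> ennreal \<epsilon>"
    using H by (intro HJ_weak_conv_asymptotically_tight[OF W[unfolded joint_limit_def] N _ _ \<epsilon>]
        always_eventually allI prob_space_PiM continuous_intros)
  thus ?thesis by auto
qed

lemma consistent_of_scaled_error_tight:
  fixes \<theta>\<^sub>0 :: "real^'d"
  assumes tight: "\<And>\<epsilon>. 0 < \<epsilon> \<Longrightarrow> \<exists>c. \<forall>\<^sub>F n in sequentially. outer_measure_of (\<Pi>\<^sub>M i\<in>{..<n}. H)
      {x \<in> space (\<Pi>\<^sub>M i\<in>{..<n}. H). c \<le> norm (sqrt (real n) *\<^sub>R (\<theta>est n x - \<theta>\<^sub>0))} \<le> ennreal \<epsilon>"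
  shows "consistent_under \<theta>est H \<theta>\<^sub>0"
  unfolding consistent_under_def
proof (intro allI impI)
  fix \<delta> :: real assume \<delta>: "0 < \<delta>"
  let ?B = "\<lambda>n. {x \<in> space (\<Pi>\<^sub>M i\<in>{..<n}. H). \<delta> < dist (\<theta>est n x) \<theta>\<^sub>0}"
  have "(\<lambda>n. outer_measure_of (\<Pi>\<^sub>M i\<in>{..<n}. H) (?B n)) \<longlonglongrightarrow> ennreal 0"
  proof (rule tendsto_ennreal_if_eventually_between)
    fix \<epsilon> :: real assume "0 < \<epsilon>"
    then obtain c where "\<forall>\<^sub>F n in sequentially. outer_measure_of (\<Pi>\<^sub>M i\<in>{..<n}. H)
      {x \<in> space (\<Pi>\<^sub>M i\<in>{..<n}. H). c \<le> norm (sqrt (real n) *\<^sub>R (\<theta>est n x - \<theta>\<^sub>0))} \<le> ennreal \<epsilon>"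
      using tight by blast
    moreover have "\<forall>\<^sub>F n in sequentially. c / \<delta> < sqrt (real n)"
      using filterlim_compose[OF sqrt_at_top filterlim_real_sequentially]
      by (auto simp: filterlim_at_top_dense)
    ultimately show "\<forall>\<^sub>F n in sequentially. outer_measure_of (\<Pi>\<^sub>M i\<in>{..<n}. H) (?B n) \<le> ennreal (0 + \<epsilon>)"
    proof eventually_elim
      case (elim n)
      have "c \<le> norm (sqrt (real n) *\<^sub>R (\<theta>est n x - \<theta>\<^sub>0))" if "\<delta> < dist (\<theta>est n x) \<theta>\<^sub>0" for x
      proof -
        have "c \<le> sqrt (real n) * \<delta>" using elim(2) \<delta> by (simp add: field_simps)
        also have "\<dots> \<le> sqrt (real n) * norm (\<theta>est n x - \<theta>\<^sub>0)"
          using that by (intro mult_left_mono) (auto simp: dist_norm)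
        finally show ?thesis by simp
      qed
      hence "outer_measure_of (\<Pi>\<^sub>M i\<in>{..<n}. H) (?B n) \<le> outer_measure_of (\<Pi>\<^sub>M i\<in>{..<n}. H)
        {x \<in> space (\<Pi>\<^sub>M i\<in>{..<n}. H). c \<le> norm (sqrt (real n) *\<^sub>R (\<theta>est n x - \<theta>\<^sub>0))}"
        by (intro outer_measure_of_mono) auto
      also have "\<dots> \<le> ennreal \<epsilon>" by (rule elim(1))
      finally show ?case by simp
    qed
  qed (simp_all add: ennreal_neg)
  thus "(\<lambda>n. outer_measure_of (\<Pi>\<^sub>M i\<in>{..<n}. H) (?B n)) \<longlonglongrightarrow> 0" by simp
qed

text \<open>The rescaled errors of the estimator stay, up to small probability, in a ball. It is compact, so
  what holds eventually along each convergent sequence of local parameters holds eventually on the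
  whole ball at once.\<close>

lemma sequences_control_of_C1:
  fixes \<theta>\<^sub>0 :: "real^'d" and A :: "'x measure"
  assumes sets: "sets H = sets A"
    and tight: "\<And>\<epsilon>. 0 < \<epsilon> \<Longrightarrow> \<exists>c. \<forall>\<^sub>F n in sequentially. outer_measure_of (\<Pi>\<^sub>M i\<in>{..<n}. H)
      {x \<in> space (\<Pi>\<^sub>M i\<in>{..<n}. H). c \<le> norm (sqrt (real n) *\<^sub>R (\<theta>est n x - \<theta>\<^sub>0))} \<le> ennreal \<epsilon>"
    and C1: "cond_C1 A emb \<theta>est Hm \<theta>\<^sub>0 N Z"
  shows "sequences_control A emb \<theta>est Hm H \<theta>\<^sub>0 N Z"
  unfolding sequences_control_def
proof (intro allI impI)
  fix good :: "nat \<Rightarrow> (nat \<Rightarrow> 'x) \<Rightarrow> bool" and \<epsilon> :: real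
  assume good: "\<forall>\<theta>s. \<theta>s \<longlonglongrightarrow> \<theta>\<^sub>0 \<and> joint_limit A emb \<theta>est (\<lambda>n. Hm (\<theta>s n)) \<theta>s N Z \<longrightarrow>
    (\<forall>\<^sub>F n in sequentially. \<forall>x\<in>space (\<Pi>\<^sub>M i\<in>{..<n}. A). \<theta>est n x = \<theta>s n \<longrightarrow> good n x)" and "0 < \<epsilon>"
  then obtain c where c: "\<forall>\<^sub>F n in sequentially. outer_measure_of (\<Pi>\<^sub>M i\<in>{..<n}. H)
      {x \<in> space (\<Pi>\<^sub>M i\<in>{..<n}. H). c \<le> norm (sqrt (real n) *\<^sub>R (\<theta>est n x - \<theta>\<^sub>0))} \<le> ennreal \<epsilon>"
    using tight by blast
  have "\<forall>\<^sub>F n in sequentially. \<forall>h\<in>cball 0 c. \<forall>x\<in>space (\<Pi>\<^sub>M i\<in>{..<n}. A).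
      \<theta>est n x = \<theta>\<^sub>0 + h /\<^sub>R sqrt (real n) \<longrightarrow> good n x"
  proof (rule eventually_compact_if_eventually_along_sequences[OF compact_cball])
    fix h :: "nat \<Rightarrow> real^'d" and l assume h: "h \<longlonglongrightarrow> l"
    have "(\<lambda>n. inverse (sqrt (real n))) \<longlonglongrightarrow> 0"
      by (rule tendsto_inverse_0_at_top[OF filterlim_compose[OF sqrt_at_top filterlim_real_sequentially]])
    hence "(\<lambda>n. \<theta>\<^sub>0 + h n /\<^sub>R sqrt (real n)) \<longlonglongrightarrow> \<theta>\<^sub>0 + 0 *\<^sub>R l"
      using h by (intro tendsto_intros)
    moreover have "joint_limit A emb \<theta>est (\<lambda>n. Hm (\<theta>\<^sub>0 + h n /\<^sub>R sqrt (real n)))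
        (\<lambda>n. \<theta>\<^sub>0 + h n /\<^sub>R sqrt (real n)) N Z"
      using C1 h unfolding cond_C1_def by blast
    ultimately show "\<forall>\<^sub>F n in sequentially. \<forall>x\<in>space (\<Pi>\<^sub>M i\<in>{..<n}. A).
      \<theta>est n x = \<theta>\<^sub>0 + h n /\<^sub>R sqrt (real n) \<longrightarrow> good n x"
      using good by simp
  qed
  with c show "\<forall>\<^sub>F n in sequentially.
      outer_measure_of (\<Pi>\<^sub>M i\<in>{..<n}. H) {x \<in> space (\<Pi>\<^sub>M i\<in>{..<n}. H). \<not> good n x} \<le> ennreal \<epsilon>"
    using eventually_ge_at_top[of 1]
  proof eventually_elim
    case (elim n)
    have "c \<le> norm (sqrt (real n) *\<^sub>R (\<theta>est n x - \<theta>\<^sub>0))"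
      if x: "x \<in> space (\<Pi>\<^sub>M i\<in>{..<n}. H)" "\<not> good n x" for x
    proof (rule ccontr)
      assume "\<not> ?thesis"
      hence "sqrt (real n) *\<^sub>R (\<theta>est n x - \<theta>\<^sub>0) \<in> cball 0 c" by simp
      moreover have "\<theta>est n x = \<theta>\<^sub>0 + (sqrt (real n) *\<^sub>R (\<theta>est n x - \<theta>\<^sub>0)) /\<^sub>R sqrt (real n)"
        using elim(3) by simp
      ultimately show False
        using elim(2) x unfolding space_PiM_cong_sets[OF sets] by blast
    qed
    hence "outer_measure_of (\<Pi>\<^sub>M i\<in>{..<n}. H) {x \<in> space (\<Pi>\<^sub>M i\<in>{..<n}. H). \<not> good n x}
      \<le> outer_measure_of (\<Pi>\<^sub>M i\<in>{..<n}. H)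
      {x \<in> space (\<Pi>\<^sub>M i\<in>{..<n}. H). c \<le> norm (sqrt (real n) *\<^sub>R (\<theta>est n x - \<theta>\<^sub>0))}"
      by (intro outer_measure_of_mono) auto
    with elim(1) show ?case by (rule order_trans[rotated])
  qed
qed

lemma consistent_under_eventually:
  assumes "consistent_under \<theta>est H \<theta>\<^sub>0" "0 < \<delta>" "0 < \<epsilon>"
  shows "\<forall>\<^sub>F n in sequentially. outer_measure_of (\<Pi>\<^sub>M i\<in>{..<n}. H)
    {x \<in> space (\<Pi>\<^sub>M i\<in>{..<n}. H). \<delta> < dist (\<theta>est n x) \<theta>\<^sub>0} \<le> ennreal \<epsilon>"
proof -
  have "(\<lambda>n. outer_measure_of (\<Pi>\<^sub>M i\<in>{..<n}. H)
    {x \<in> space (\<Pi>\<^sub>M i\<in>{..<n}. H). \<delta> < dist (\<theta>est n x) \<theta>\<^sub>0}) \<longlonglongrightarrow> 0"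
    using assms by (simp add: consistent_under_def)
  from order_tendstoD(2)[OF this, of "ennreal \<epsilon>"] assms(3) show ?thesis
    by (auto elim!: eventually_mono)
qed

text \<open>The limit theorem is now available along all sequences that converge to \<open>\<theta>\<^sub>0\<close>, at whatever rate.
  Hence what is to be shown holds on a whole neighbourhood of \<open>\<theta>\<^sub>0\<close> from some index on, and
  consistency puts the estimates there.\<close>

lemma sequences_control_of_C2:
  fixes \<theta>\<^sub>0 :: "real^'d" and A :: "'x measure"
  assumes sets: "sets H = sets A"
    and cons: "consistent_under \<theta>est H \<theta>\<^sub>0"
    and C2: "cond_C2 A emb \<theta>est Hm \<theta>\<^sub>0 N Z"
  shows "sequences_control A emb \<theta>est Hm H \<theta>\<^sub>0 N Z"
  unfolding sequences_control_def
proof (intro allI impI)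
  fix good :: "nat \<Rightarrow> (nat \<Rightarrow> 'x) \<Rightarrow> bool" and \<epsilon> :: real
  assume good: "\<forall>\<theta>s. \<theta>s \<longlonglongrightarrow> \<theta>\<^sub>0 \<and> joint_limit A emb \<theta>est (\<lambda>n. Hm (\<theta>s n)) \<theta>s N Z \<longrightarrow>
    (\<forall>\<^sub>F n in sequentially. \<forall>x\<in>space (\<Pi>\<^sub>M i\<in>{..<n}. A). \<theta>est n x = \<theta>s n \<longrightarrow> good n x)" and \<epsilon>: "0 < \<epsilon>"
  have "\<exists>\<delta>>0. \<forall>\<^sub>F n in sequentially. \<forall>t\<in>ball \<theta>\<^sub>0 \<delta>. \<forall>x\<in>space (\<Pi>\<^sub>M i\<in>{..<n}. A).
      \<theta>est n x = t \<longrightarrow> good n x"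
    using good C2 unfolding cond_C2_def
    by (intro eventually_ball_if_eventually_along_sequences) blast
  then obtain \<delta> where \<delta>: "\<delta> > 0" and ev: "\<forall>\<^sub>F n in sequentially. \<forall>t\<in>ball \<theta>\<^sub>0 \<delta>.
      \<forall>x\<in>space (\<Pi>\<^sub>M i\<in>{..<n}. A). \<theta>est n x = t \<longrightarrow> good n x" by blast
  have "\<forall>\<^sub>F n in sequentially. outer_measure_of (\<Pi>\<^sub>M i\<in>{..<n}. H)
    {x \<in> space (\<Pi>\<^sub>M i\<in>{..<n}. H). \<delta> / 2 < dist (\<theta>est n x) \<theta>\<^sub>0} \<le> ennreal \<epsilon>"
    using cons \<delta> \<epsilon> by (intro consistent_under_eventually) auto
  with ev show "\<forall>\<^sub>F n in sequentially.
      outer_measure_of (\<Pi>\<^sub>M i\<in>{..<n}. H) {x \<in> space (\<Pi>\<^sub>M i\<in>{..<n}. H). \<not> good n x} \<le> ennreal \<epsilon>"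
  proof eventually_elim
    case (elim n)
    have "good n x" if "x \<in> space (\<Pi>\<^sub>M i\<in>{..<n}. A)" "dist (\<theta>est n x) \<theta>\<^sub>0 \<le> \<delta> / 2" for x
    proof -
      have "\<theta>est n x \<in> ball \<theta>\<^sub>0 \<delta>" using that(2) \<delta> by (simp add: dist_commute)
      thus ?thesis using elim(1) that(1) by blast
    qed
    hence "{x \<in> space (\<Pi>\<^sub>M i\<in>{..<n}. H). \<not> good n x}
      \<subseteq> {x \<in> space (\<Pi>\<^sub>M i\<in>{..<n}. H). \<delta> / 2 < dist (\<theta>est n x) \<theta>\<^sub>0}"
      unfolding space_PiM_cong_sets[OF sets] using not_le by blast
    from outer_measure_of_mono[OF this] elim(2) show ?case by (rule order_trans)
  qed
qed

section \<open>Level and power of the bootstrap test\<close>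

text \<open>Because the bootstrap resamples from the fitted model, its centred statistic is the original
  statistic of the resampled data; the locale therefore speaks of \<open>gof_stat\<close> only.\<close>

locale parametric_bootstrap_test =
  fixes A :: "'x measure"
    and D :: "'x measure set"
    and emb :: "'x measure \<Rightarrow> 'e::real_normed_vector"
    and \<Theta> :: "(real^'d) set"
    and Hm :: "real^'d \<Rightarrow> 'x measure"
    and dH :: "real^'d \<Rightarrow> (real^'d) \<Rightarrow>\<^sub>L 'e"
    and \<theta>est :: "nat \<Rightarrow> (nat \<Rightarrow> 'x) \<Rightarrow> real^'d"
    and Q :: "'z measure"
    and Xs :: "nat \<Rightarrow> (nat \<Rightarrow> 'x) \<Rightarrow> 'z \<Rightarrow> (nat \<Rightarrow> 'x)"
    and \<xi> :: "nat \<Rightarrow> (nat \<Rightarrow> 'x) \<Rightarrow> real"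
    and \<alpha> :: real
  assumes D: "D \<subseteq> space (prob_algebra A)"
    and model: "Hm ` \<Theta> \<subseteq> D"
    and emb: "measure_embedding A D emb"
    and open_Theta: "open \<Theta>"
    and differentiable: "continuously_hadamard_differentiable (\<lambda>t. emb (Hm t)) dH \<Theta>"
    and Q: "prob_space Q"
    and bootstrap: "\<And>n. 1 \<le> n \<Longrightarrow> bootstrap_sample A Q n (\<lambda>x. Hm (\<theta>est n x)) (Xs n)"
    and gof_measurable: "\<And>n x. 1 \<le> n \<Longrightarrow> x \<in> space (\<Pi>\<^sub>M i\<in>{..<n}. A) \<Longrightarrow>
         (\<lambda>z. gof_stat A emb Hm \<theta>est n (Xs n x z)) \<in> borel_measurable Q"
    and xi_quantile: "\<And>n x. 1 \<le> n \<Longrightarrow> x \<in> space (\<Pi>\<^sub>M i\<in>{..<n}. A) \<Longrightarrow>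
         is_quantile (distr Q borel (\<lambda>z. gof_stat A emb Hm \<theta>est n (Xs n x z))) (1 - \<alpha>) (\<xi> n x)"
    and alpha: "0 < \<alpha>" "\<alpha> < 1"
begin

abbreviation T where "T \<equiv> gof_stat A emb Hm \<theta>est"

abbreviation limit_stat :: "real^'d \<Rightarrow> ('w \<Rightarrow> 'e \<times> (real^'d)) \<Rightarrow> 'w \<Rightarrow> real" where
  "limit_stat \<theta>\<^sub>0 Z w \<equiv> norm (fst (Z w) - dH \<theta>\<^sub>0 (snd (Z w)))"

lemma limit_stat_measurable:
  assumes "Z \<in> borel_measurable N"
  shows "limit_stat \<theta>\<^sub>0 Z \<in> borel_measurable N"
proof -
  have "continuous_on UNIV (\<lambda>p::'e \<times> (real^'d). norm (fst p - dH \<theta>\<^sub>0 (snd p)))"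
    by (intro continuous_intros)
  from measurable_compose[OF assms borel_measurable_continuous_onI[OF this]] show ?thesis .
qed

lemma prob_space_D: "H \<in> D \<Longrightarrow> prob_space H" and sets_D: "H \<in> D \<Longrightarrow> sets H = sets A"
  using D by (auto simp: space_prob_algebra)

lemma prob_space_sample: "H \<in> D \<Longrightarrow> prob_space (\<Pi>\<^sub>M i\<in>{..<n::nat}. H)"
  by (intro prob_space_PiM prob_space_D)

lemma strict_derivative:
  assumes "\<theta>\<^sub>0 \<in> \<Theta>" "0 < e"
  shows "\<exists>d>0. \<forall>s\<in>ball \<theta>\<^sub>0 d. \<forall>t\<in>ball \<theta>\<^sub>0 d.
    norm (emb (Hm t) - emb (Hm s) - dH \<theta>\<^sub>0 (t - s)) \<le> e * norm (t - s)"
  by (rule continuously_hadamard_imp_strict_derivative[OF differentiable open_Theta assms])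

lemma eventually_prob_space_sample:
  assumes "\<theta>s \<longlonglongrightarrow> \<theta>\<^sub>0" "\<theta>\<^sub>0 \<in> \<Theta>"
  shows "\<forall>\<^sub>F n in sequentially. prob_space (\<Pi>\<^sub>M i\<in>{..<n}. Hm (\<theta>s n))"
proof -
  have "\<forall>\<^sub>F n in sequentially. \<theta>s n \<in> \<Theta>"
    using assms open_Theta by (intro topological_tendstoD) auto
  thus ?thesis by eventually_elim (use model in \<open>auto intro!: prob_space_sample\<close>)
qed

lemma stat_tail_upper:
  assumes "joint_limit A emb \<theta>est (\<lambda>n. Hm (\<theta>s n)) \<theta>s N Z" "prob_space N" "\<theta>s \<longlonglongrightarrow> \<theta>\<^sub>0" "\<theta>\<^sub>0 \<in> \<Theta>"
    and "a < b" "measure N {w \<in> space N. a \<le> limit_stat \<theta>\<^sub>0 Z w} < c"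
  shows "\<forall>\<^sub>F n in sequentially. outer_measure_of (\<Pi>\<^sub>M i\<in>{..<n}. Hm (\<theta>s n))
    {x \<in> space (\<Pi>\<^sub>M i\<in>{..<n}. Hm (\<theta>s n)). b \<le> T n x} \<le> ennreal c"
  using gof_stat_signed_tail[OF assms(1,2) eventually_prob_space_sample[OF assms(3,4)] assms(3)
    strict_derivative[OF assms(4)], of 1 a b c] assms(5,6) by simp

lemma stat_tail_lower:
  assumes "joint_limit A emb \<theta>est (\<lambda>n. Hm (\<theta>s n)) \<theta>s N Z" "prob_space N" "\<theta>s \<longlonglongrightarrow> \<theta>\<^sub>0" "\<theta>\<^sub>0 \<in> \<Theta>"
    and "a < b" "measure N {w \<in> space N. limit_stat \<theta>\<^sub>0 Z w \<le> b} < c"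
  shows "\<forall>\<^sub>F n in sequentially. outer_measure_of (\<Pi>\<^sub>M i\<in>{..<n}. Hm (\<theta>s n))
    {x \<in> space (\<Pi>\<^sub>M i\<in>{..<n}. Hm (\<theta>s n)). T n x \<le> a} \<le> ennreal c"
  using gof_stat_signed_tail[OF assms(1,2) eventually_prob_space_sample[OF assms(3,4)] assms(3)
    strict_derivative[OF assms(4)], of "-1" "-b" "-a" c] assms(5,6) by simp

text \<open>Suppose that the estimates follow \<open>\<theta>s\<close> and that \<open>\<xi> n x \<le> s\<close>. Then the statistic of data generated
  at \<open>\<theta>s n\<close> is at most \<open>s\<close> with outer probability at least \<open>1 - \<alpha>\<close>. For large \<open>n\<close> this contradicts
  the weak limit, which has less mass up to \<open>b\<close>.\<close>

lemma critical_value_not_small: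
  assumes control: "sequences_control A emb \<theta>est Hm H \<theta>\<^sub>0 N Z" and N: "prob_space N" and \<theta>\<^sub>0: "\<theta>\<^sub>0 \<in> \<Theta>"
    and s: "s < b" and b: "measure N {w \<in> space N. limit_stat \<theta>\<^sub>0 Z w \<le> b} < 1 - \<alpha>" and \<epsilon>: "0 < \<epsilon>"
  shows "\<forall>\<^sub>F n in sequentially. outer_measure_of (\<Pi>\<^sub>M i\<in>{..<n}. H)
    {x \<in> space (\<Pi>\<^sub>M i\<in>{..<n}. H). \<not> s < \<xi> n x} \<le> ennreal \<epsilon>"
proof (rule control[unfolded sequences_control_def, rule_format, OF _ \<epsilon>], elim conjE)
  fix \<theta>s assume \<theta>s: "\<theta>s \<longlonglongrightarrow> \<theta>\<^sub>0" and W: "joint_limit A emb \<theta>est (\<lambda>n. Hm (\<theta>s n)) \<theta>s N Z"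
  obtain c where c: "measure N {w \<in> space N. limit_stat \<theta>\<^sub>0 Z w \<le> b} < c" "c < 1 - \<alpha>"
    using dense[OF b] by blast
  show "\<forall>\<^sub>F n in sequentially. \<forall>x\<in>space (\<Pi>\<^sub>M i\<in>{..<n}. A). \<theta>est n x = \<theta>s n \<longrightarrow> s < \<xi> n x"
    using stat_tail_lower[OF W N \<theta>s \<theta>\<^sub>0 s c(1)] eventually_ge_at_top[of 1]
  proof eventually_elim
    case (elim n)
    show ?case
    proof (intro ballI impI, rule ccontr)
      fix x assume x: "x \<in> space (\<Pi>\<^sub>M i\<in>{..<n}. A)" and est: "\<theta>est n x = \<theta>s n" and "\<not> s < \<xi> n x"
      note law = bootstrap_sample_law[OF bootstrap[OF elim(2)] Q elim(2) x, unfolded est]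
      have "ennreal (1 - \<alpha>) \<le> outer_measure_of (distr Q (\<Pi>\<^sub>M i\<in>{..<n}. A) (Xs n x))
          {y \<in> space (\<Pi>\<^sub>M i\<in>{..<n}. A). T n y \<le> s}"
        using \<open>\<not> s < \<xi> n x\<close>
        by (intro quantile_le_imp_outer_measure_ge[where T = "T n", OF Q law(1) gof_measurable[OF elim(2) x]
            xi_quantile[OF elim(2) x]]) simp
      also have "space (\<Pi>\<^sub>M i\<in>{..<n}. A) = space (\<Pi>\<^sub>M i\<in>{..<n}. Hm (\<theta>s n))"
        using arg_cong[OF law(2), of space] by simp
      also have "outer_measure_of (distr Q (\<Pi>\<^sub>M i\<in>{..<n}. A) (Xs n x))
          {y \<in> space (\<Pi>\<^sub>M i\<in>{..<n}. Hm (\<theta>s n)). T n y \<le> s} \<le> ennreal c"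
        unfolding law(2) by (rule elim(1))
      finally show False using c alpha by (simp add: ennreal_le_iff2)
    qed
  qed
qed

lemma critical_value_not_large:
  assumes control: "sequences_control A emb \<theta>est Hm H \<theta>\<^sub>0 N Z" and N: "prob_space N" and \<theta>\<^sub>0: "\<theta>\<^sub>0 \<in> \<Theta>"
    and s: "a < s" and a: "measure N {w \<in> space N. a \<le> limit_stat \<theta>\<^sub>0 Z w} < \<alpha>" and \<epsilon>: "0 < \<epsilon>"
  shows "\<forall>\<^sub>F n in sequentially. outer_measure_of (\<Pi>\<^sub>M i\<in>{..<n}. H)
    {x \<in> space (\<Pi>\<^sub>M i\<in>{..<n}. H). \<not> \<xi> n x < s} \<le> ennreal \<epsilon>"
proof (rule control[unfolded sequences_control_def, rule_format, OF _ \<epsilon>], elim conjE)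
  fix \<theta>s assume \<theta>s: "\<theta>s \<longlonglongrightarrow> \<theta>\<^sub>0" and W: "joint_limit A emb \<theta>est (\<lambda>n. Hm (\<theta>s n)) \<theta>s N Z"
  obtain c where c: "measure N {w \<in> space N. a \<le> limit_stat \<theta>\<^sub>0 Z w} < c" "c < \<alpha>"
    using dense[OF a] by blast
  show "\<forall>\<^sub>F n in sequentially. \<forall>x\<in>space (\<Pi>\<^sub>M i\<in>{..<n}. A). \<theta>est n x = \<theta>s n \<longrightarrow> \<xi> n x < s"
    using stat_tail_upper[OF W N \<theta>s \<theta>\<^sub>0 s c(1)] eventually_ge_at_top[of 1]
  proof eventually_elim
    case (elim n)
    show ?case
    proof (intro ballI impI, rule ccontr)
      fix x assume x: "x \<in> space (\<Pi>\<^sub>M i\<in>{..<n}. A)" and est: "\<theta>est n x = \<theta>s n" and "\<not> \<xi> n x < s"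
      note law = bootstrap_sample_law[OF bootstrap[OF elim(2)] Q elim(2) x, unfolded est]
      have "ennreal (1 - (1 - \<alpha>)) \<le> outer_measure_of (distr Q (\<Pi>\<^sub>M i\<in>{..<n}. A) (Xs n x))
          {y \<in> space (\<Pi>\<^sub>M i\<in>{..<n}. A). s \<le> T n y}"
        using \<open>\<not> \<xi> n x < s\<close>
        by (intro quantile_ge_imp_outer_measure_ge[where T = "T n", OF Q law(1) gof_measurable[OF elim(2) x]
            xi_quantile[OF elim(2) x]]) simp
      also have "space (\<Pi>\<^sub>M i\<in>{..<n}. A) = space (\<Pi>\<^sub>M i\<in>{..<n}. Hm (\<theta>s n))"
        using arg_cong[OF law(2), of space] by simp
      also have "outer_measure_of (distr Q (\<Pi>\<^sub>M i\<in>{..<n}. A) (Xs n x))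
          {y \<in> space (\<Pi>\<^sub>M i\<in>{..<n}. Hm (\<theta>s n)). s \<le> T n y} \<le> ennreal c"
        unfolding law(2) by (rule elim(1))
      finally show False using c alpha by (simp add: ennreal_le_iff2)
    qed
  qed
qed

abbreviation joint_law where "joint_law n H \<equiv> (\<Pi>\<^sub>M i\<in>{..<n::nat}. H) \<Otimes>\<^sub>M Q"

lemma sample_event_eq_times:
  "{(x, z) \<in> space (M \<Otimes>\<^sub>M Q). P x} = {x \<in> space M. P x} \<times> space Q"
  by (auto simp: space_pair_measure)

lemma outer_measure_of_sample_event_le:
  assumes "{x \<in> space M. P x} \<subseteq> {x \<in> space M. P1 x} \<union> {x \<in> space M. P2 x}"
    and "outer_measure_of M {x \<in> space M. P1 x} \<le> ennreal a" "outer_measure_of M {x \<in> space M. P2 x} \<le> ennreal b"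
    and ab: "0 \<le> a" "0 \<le> b"
  shows "outer_measure_of (M \<Otimes>\<^sub>M Q) {(x, z) \<in> space (M \<Otimes>\<^sub>M Q). P x} \<le> ennreal (a + b)"
proof -
  have "outer_measure_of (M \<Otimes>\<^sub>M Q) {(x, z) \<in> space (M \<Otimes>\<^sub>M Q). P x} \<le> outer_measure_of M {x \<in> space M. P x}"
    unfolding sample_event_eq_times by (rule outer_measure_of_times_space_le[OF Q]) auto
  also have "\<dots> \<le> outer_measure_of M {x \<in> space M. P1 x} + outer_measure_of M {x \<in> space M. P2 x}"
    by (rule outer_measure_of_subset_Un_le[OF assms(1)]) auto
  also have "\<dots> \<le> ennreal a + ennreal b" by (intro add_mono assms(2,3))
  finally show ?thesis using ab by simp
qed

lemma inner_measure_of_sample_event_ge: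
  assumes M: "prob_space M" and le: "outer_measure_of (M \<Otimes>\<^sub>M Q) {(x, z) \<in> space (M \<Otimes>\<^sub>M Q). \<not> P x} \<le> ennreal c"
    and c: "0 \<le> c"
  shows "ennreal (1 - c) \<le> inner_measure_of (M \<Otimes>\<^sub>M Q) {(x, z) \<in> space (M \<Otimes>\<^sub>M Q). P x}"
proof (rule inner_measure_of_ge[OF _ _ _ c])
  show "prob_space (M \<Otimes>\<^sub>M Q)" by (rule prob_space_pair[OF M Q])
  have "space (M \<Otimes>\<^sub>M Q) - {(x, z) \<in> space (M \<Otimes>\<^sub>M Q). P x} = {(x, z) \<in> space (M \<Otimes>\<^sub>M Q). \<not> P x}" by auto
  with le show "outer_measure_of (M \<Otimes>\<^sub>M Q) (space (M \<Otimes>\<^sub>M Q) - {(x, z) \<in> space (M \<Otimes>\<^sub>M Q). P x}) \<le> ennreal c"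
    by simp
qed auto

text \<open>Up to a set of small probability the critical value lies in any given neighbourhood of the
  interval of \<open>(1 - \<alpha>)\<close>-quantiles of the limit variable. Replacing it by a constant just left or just
  right of that interval bounds the rejection probability from above and from below, and since the
  end points are not atoms, both bounds are close to \<open>\<alpha>\<close>.\<close>

lemma asymptotic_level:
  assumes \<theta>\<^sub>0: "\<theta>\<^sub>0 \<in> \<Theta>" and N: "prob_space N" and Z: "Z \<in> borel_measurable N"
    and W: "joint_limit A emb \<theta>est (\<lambda>_. Hm \<theta>\<^sub>0) (\<lambda>_. \<theta>\<^sub>0) N Z"
    and control: "sequences_control A emb \<theta>est Hm (Hm \<theta>\<^sub>0) \<theta>\<^sub>0 N Z"
    and no_atom: "\<And>q. is_quantile (distr N borel (limit_stat \<theta>\<^sub>0 Z)) (1 - \<alpha>) q \<Longrightarrow>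
      measure (distr N borel (limit_stat \<theta>\<^sub>0 Z)) {q} = 0"
  defines "B \<equiv> \<lambda>n. {(x, z) \<in> space (joint_law n (Hm \<theta>\<^sub>0)). \<xi> n x \<le> T n x}"
  shows "(\<lambda>n. outer_measure_of (joint_law n (Hm \<theta>\<^sub>0)) (B n)) \<longlonglongrightarrow> ennreal \<alpha>"
    and "(\<lambda>n. inner_measure_of (joint_law n (Hm \<theta>\<^sub>0)) (B n)) \<longlonglongrightarrow> ennreal \<alpha>"
proof -
  interpret N: prob_space N by fact
  note L = limit_stat_measurable[OF Z, of \<theta>\<^sub>0]
  let ?F = "distr N borel (limit_stat \<theta>\<^sub>0 Z)"
  interpret F: real_distribution ?F using L by simp
  have F: "measure ?F S = measure N {w \<in> space N. limit_stat \<theta>\<^sub>0 Z w \<in> S}" if "S \<in> sets borel" for S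
    using L that by (subst measure_distr) (auto intro!: arg_cong[of _ _ "measure N"])
  have up: "\<forall>\<^sub>F n in sequentially. outer_measure_of (joint_law n (Hm \<theta>\<^sub>0)) (B n) \<le> ennreal (\<alpha> + \<epsilon>)"
    if \<epsilon>: "0 < \<epsilon>" for \<epsilon>
  proof -
    obtain a b where ab: "a < b" "measure ?F {..b} < 1 - \<alpha>" "measure ?F {a..} < 1 - (1 - \<alpha>) + \<epsilon> / 2"
      using quantile_approach_from_below[where p = "1 - \<alpha>" and e = "\<epsilon> / 2", OF F.real_distribution_axioms _ _ _ no_atom] alpha \<epsilon> by auto
    define s where "s = (a + b) / 2"
    have s: "a < s" "s < b" using ab by (auto simp: s_def)
    have "\<forall>\<^sub>F n in sequentially. outer_measure_of (\<Pi>\<^sub>M i\<in>{..<n}. Hm \<theta>\<^sub>0)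
        {x \<in> space (\<Pi>\<^sub>M i\<in>{..<n}. Hm \<theta>\<^sub>0). s \<le> T n x} \<le> ennreal (\<alpha> + \<epsilon> / 2)"
      using ab(3) by (intro stat_tail_upper[OF W N tendsto_const \<theta>\<^sub>0 s(1)]) (simp add: F)
    moreover have "\<forall>\<^sub>F n in sequentially. outer_measure_of (\<Pi>\<^sub>M i\<in>{..<n}. Hm \<theta>\<^sub>0)
        {x \<in> space (\<Pi>\<^sub>M i\<in>{..<n}. Hm \<theta>\<^sub>0). \<not> s < \<xi> n x} \<le> ennreal (\<epsilon> / 2)"
      using ab(2) \<epsilon> by (intro critical_value_not_small[OF control N \<theta>\<^sub>0 s(2)]) (simp_all add: F)
    ultimately show ?thesis
    proof eventually_elim
      case (elim n)
      have "outer_measure_of (joint_law n (Hm \<theta>\<^sub>0)) (B n) \<le> ennreal ((\<alpha> + \<epsilon> / 2) + \<epsilon> / 2)"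
        unfolding B_def
        by (rule outer_measure_of_sample_event_le[OF _ elim]) (use alpha \<epsilon> in auto)
      thus ?case by (simp add: add.commute)
    qed
  qed
  have low: "\<forall>\<^sub>F n in sequentially. ennreal (\<alpha> - \<epsilon>) \<le> inner_measure_of (joint_law n (Hm \<theta>\<^sub>0)) (B n)"
    if \<epsilon>: "0 < \<epsilon>" for \<epsilon>
  proof -
    obtain a b where ab: "a < b" "1 - \<alpha> < measure ?F {..<a}" "measure ?F {..b} < (1 - \<alpha>) + \<epsilon> / 2"
      using quantile_approach_from_above[where p = "1 - \<alpha>" and e = "\<epsilon> / 2", OF F.real_distribution_axioms _ _ _ no_atom] alpha \<epsilon> by auto
    define s where "s = (a + b) / 2"
    have s: "a < s" "s < b" using ab by (auto simp: s_def)
    have "measure ?F {a..} = 1 - measure ?F {..<a}"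
      using F.prob_compl[of "{..<a}"] by (simp add: Compl_eq_Diff_UNIV[symmetric])
    hence a: "measure ?F {a..} < \<alpha>" using ab by simp
    have "\<forall>\<^sub>F n in sequentially. outer_measure_of (\<Pi>\<^sub>M i\<in>{..<n}. Hm \<theta>\<^sub>0)
        {x \<in> space (\<Pi>\<^sub>M i\<in>{..<n}. Hm \<theta>\<^sub>0). T n x \<le> s} \<le> ennreal (1 - \<alpha> + \<epsilon> / 2)"
      using ab(3) by (intro stat_tail_lower[OF W N tendsto_const \<theta>\<^sub>0 s(2)]) (simp add: F)
    moreover have "\<forall>\<^sub>F n in sequentially. outer_measure_of (\<Pi>\<^sub>M i\<in>{..<n}. Hm \<theta>\<^sub>0)
        {x \<in> space (\<Pi>\<^sub>M i\<in>{..<n}. Hm \<theta>\<^sub>0). \<not> \<xi> n x < s} \<le> ennreal (\<epsilon> / 2)"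
      using a \<epsilon> by (intro critical_value_not_large[OF control N \<theta>\<^sub>0 s(1)]) (simp_all add: F)
    ultimately show ?thesis
    proof eventually_elim
      case (elim n)
      have "outer_measure_of (joint_law n (Hm \<theta>\<^sub>0))
          {(x, z) \<in> space (joint_law n (Hm \<theta>\<^sub>0)). \<not> \<xi> n x \<le> T n x} \<le> ennreal ((1 - \<alpha> + \<epsilon> / 2) + \<epsilon> / 2)"
        by (rule outer_measure_of_sample_event_le[OF _ elim]) (use alpha \<epsilon> in auto)
      hence "ennreal (1 - ((1 - \<alpha> + \<epsilon> / 2) + \<epsilon> / 2)) \<le> inner_measure_of (joint_law n (Hm \<theta>\<^sub>0)) (B n)"
        unfolding B_def using model \<theta>\<^sub>0 alpha \<epsilon>
        by (intro inner_measure_of_sample_event_ge prob_space_sample) auto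
      thus ?case by simp
    qed
  qed
  show "(\<lambda>n. outer_measure_of (joint_law n (Hm \<theta>\<^sub>0)) (B n)) \<longlonglongrightarrow> ennreal \<alpha>"
  proof (rule tendsto_ennreal_if_eventually_between[OF up])
    show "\<forall>\<^sub>F n in sequentially. ennreal (\<alpha> - \<epsilon>) \<le> outer_measure_of (joint_law n (Hm \<theta>\<^sub>0)) (B n)" if "0 < \<epsilon>" for \<epsilon>
      using low[OF that] by eventually_elim (rule order_trans[OF _ inner_measure_of_le_outer])
  qed (use alpha in auto)
  show "(\<lambda>n. inner_measure_of (joint_law n (Hm \<theta>\<^sub>0)) (B n)) \<longlonglongrightarrow> ennreal \<alpha>"
  proof (rule tendsto_ennreal_if_eventually_between[OF _ low])
    show "\<forall>\<^sub>F n in sequentially. inner_measure_of (joint_law n (Hm \<theta>\<^sub>0)) (B n) \<le> ennreal (\<alpha> + \<epsilon>)" if "0 < \<epsilon>" for \<epsilon>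
      using up[OF that] by eventually_elim (rule order_trans[OF inner_measure_of_le_outer])
  qed (use alpha in auto)
qed

lemma functional_of_empirical_measure:
  fixes \<phi> :: "'e \<Rightarrow>\<^sub>L real"
  assumes "\<And>P. P \<in> {empirical A n x | n x. 1 \<le> n \<and> x \<in> space (\<Pi>\<^sub>M i\<in>{..<n}. A)} \<Longrightarrow>
      \<phi> (emb P) = (\<integral>y. \<phi> (emb (return A y)) \<partial>P)"
    and meas: "(\<lambda>y. \<phi> (emb (return A y))) \<in> borel_measurable A"
    and n: "1 \<le> n" and x: "x \<in> space (\<Pi>\<^sub>M i\<in>{..<n}. A)"
  shows "\<phi> (emb (empirical A n x)) = (\<Sum>i<n. \<phi> (emb (return A (x i)))) / real n"
proof -
  have "x \<in> uniform_count_measure {..<n} \<rightarrow>\<^sub>M A"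
    using x by (auto simp: measurable_def sets_uniform_count_measure space_uniform_count_measure space_PiM)
  hence "(\<integral>y. \<phi> (emb (return A y)) \<partial>empirical A n x)
      = (\<integral>i. \<phi> (emb (return A (x i))) \<partial>uniform_count_measure {..<n})"
    unfolding empirical_eq_distr[OF n x] using meas by (rule integral_distr)
  also have "\<dots> = (\<Sum>i<n. \<phi> (emb (return A (x i)))) / real n"
    by (simp add: integral_uniform_count_measure)
  finally have "(\<integral>y. \<phi> (emb (return A y)) \<partial>empirical A n x) = (\<Sum>i<n. \<phi> (emb (return A (x i)))) / real n" .
  moreover have "empirical A n x \<in> {empirical A n x | n x. 1 \<le> n \<and> x \<in> space (\<Pi>\<^sub>M i\<in>{..<n}. A)}"
    using n x by blast
  ultimately show ?thesis by (simp only: assms(1))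
qed

text \<open>The critical values are bounded in probability, so it is enough that the statistic divided by
  \<open>\<surd>n\<close> stays away from \<open>0\<close>. Some functional \<open>\<phi>\<close> of the family behind the embedding separates \<open>H\<close> from
  the limit \<open>Hm \<theta>\<^sub>0\<close> of the fitted models. Its value at the empirical measure is a sample mean,
  which converges to its value at \<open>H\<close> by the law of large numbers, while its value at the fitted
  model converges to its value at \<open>Hm \<theta>\<^sub>0\<close>.\<close>

lemma asymptotic_power:
  assumes H: "H \<in> D" and \<theta>\<^sub>0: "\<theta>\<^sub>0 \<in> \<Theta>" and ne: "emb H \<noteq> emb (Hm \<theta>\<^sub>0)"
    and cons: "consistent_under \<theta>est H \<theta>\<^sub>0"
    and N: "prob_space N" and Z: "Z \<in> borel_measurable N"
    and control: "sequences_control A emb \<theta>est Hm H \<theta>\<^sub>0 N Z"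
  shows "(\<lambda>n. inner_measure_of (joint_law n H) {(x, z) \<in> space (joint_law n H). \<xi> n x < T n x}) \<longlonglongrightarrow> 1"
proof -
  let ?E = "{empirical A n x | n x. 1 \<le> n \<and> x \<in> space (\<Pi>\<^sub>M i\<in>{..<n}. A)}"
  obtain \<Phi> :: "('e \<Rightarrow>\<^sub>L real) set"
    where sep: "\<forall>u. (\<forall>\<phi>\<in>\<Phi>. blinfun_apply \<phi> u = 0) \<longrightarrow> u = 0"
    and \<Phi>: "\<forall>\<phi>\<in>\<Phi>. \<forall>P \<in> D \<union> ?E. integrable P (\<lambda>y. blinfun_apply \<phi> (emb (return A y))) \<and>
      blinfun_apply \<phi> (emb P) = (\<integral>y. blinfun_apply \<phi> (emb (return A y)) \<partial>P)"
    using emb unfolding measure_embedding_def by blast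
  obtain \<phi> where \<phi>: "\<phi> \<in> \<Phi>" and ne': "\<phi> (emb H - emb (Hm \<theta>\<^sub>0)) \<noteq> 0"
    using sep[rule_format, of "emb H - emb (Hm \<theta>\<^sub>0)"] ne by auto
  have int: "integrable P (\<lambda>y. \<phi> (emb (return A y)))"
    and rep: "\<phi> (emb P) = (\<integral>y. \<phi> (emb (return A y)) \<partial>P)" if "P \<in> D \<union> ?E" for P
    using \<Phi> \<phi> that by blast+
  define g where "g y = \<phi> (emb (return A y))" for y
  \<comment> \<open>A third of the separation: one third each is lost to the empirical measure and to the
    fitted model.\<close>
  define r where "r = \<bar>\<phi> (emb H) - \<phi> (emb (Hm \<theta>\<^sub>0))\<bar> / 3"
  have r: "r > 0" using ne' by (simp add: r_def blinfun.diff_right)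
  have gi: "integrable H g" and gH: "\<phi> (emb H) = (\<integral>y. g y \<partial>H)"
    using int[of H] rep[of H] H by (auto simp: g_def[abs_def])
  have gA: "g \<in> borel_measurable A" using gi sets_D[OF H] by (auto cong: measurable_cong_sets)
  have "((\<lambda>t. emb (Hm t)) has_derivative dH \<theta>\<^sub>0) (at \<theta>\<^sub>0)"
    using differentiable \<theta>\<^sub>0 open_Theta unfolding continuously_hadamard_differentiable_def
    by (intro hadamard_derivative_imp_has_derivative) auto
  from has_derivative_continuous[OF this] have "isCont (\<lambda>t. \<phi> (emb (Hm t))) \<theta>\<^sub>0"
    by (intro continuous_intros)
  then obtain \<delta> where \<delta>: "\<delta> > 0" "\<And>t. dist t \<theta>\<^sub>0 < \<delta> \<Longrightarrow> dist (\<phi> (emb (Hm t))) (\<phi> (emb (Hm \<theta>\<^sub>0))) < r"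
    using r unfolding continuous_at_eps_delta by metis
  from prob_tail_less[OF N limit_stat_measurable[OF Z] alpha(1)] obtain a
    where a: "measure N {w \<in> space N. a \<le> limit_stat \<theta>\<^sub>0 Z w} < \<alpha>" by blast
  \<comment> \<open>The summand \<open>1\<close> avoids showing that \<open>norm \<phi>\<close> is positive.\<close>
  define K where "K = norm \<phi> + 1"
  have K: "K > 0" by (simp add: K_def add_nonneg_pos)
  have low: "\<forall>\<^sub>F n in sequentially. ennreal (1 - \<epsilon>) \<le>
      inner_measure_of (joint_law n H) {(x, z) \<in> space (joint_law n H). \<xi> n x < T n x}" if \<epsilon>: "0 < \<epsilon>" for \<epsilon>
  proof -
    have "\<forall>\<^sub>F n in sequentially. outer_measure_of (\<Pi>\<^sub>M i\<in>{..<n}. H)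
        {x \<in> space (\<Pi>\<^sub>M i\<in>{..<n}. H). \<not> \<xi> n x < a + 1} \<le> ennreal (\<epsilon> / 3)"
      by (rule critical_value_not_large[OF control N \<theta>\<^sub>0 _ a]) (use \<epsilon> in auto)
    moreover have "\<forall>\<^sub>F n in sequentially. outer_measure_of (\<Pi>\<^sub>M i\<in>{..<n}. H)
        {x \<in> space (\<Pi>\<^sub>M i\<in>{..<n}. H). \<delta> / 2 < dist (\<theta>est n x) \<theta>\<^sub>0} \<le> ennreal (\<epsilon> / 3)"
      by (rule consistent_under_eventually[OF cons]) (use \<delta> \<epsilon> in auto)
    moreover have "\<forall>\<^sub>F n in sequentially. measure (\<Pi>\<^sub>M i\<in>{..<n}. H)
        {x \<in> space (\<Pi>\<^sub>M i\<in>{..<n}. H). r \<le> \<bar>(\<Sum>i<n. g (x i)) / real n - (\<integral>y. g y \<partial>H)\<bar>} \<le> \<epsilon> / 3"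
      using r \<epsilon> by (intro weak_law_of_large_numbers prob_space_D H gi) auto
    moreover have "\<forall>\<^sub>F n in sequentially. (a + 1) * K / r < sqrt (real n)"
      using filterlim_compose[OF sqrt_at_top filterlim_real_sequentially]
      by (auto simp: filterlim_at_top_dense)
    ultimately show ?thesis using eventually_ge_at_top[of 1]
    proof eventually_elim
      case (elim n)
      let ?P = "\<Pi>\<^sub>M i\<in>{..<n}. H"
      interpret P: prob_space ?P by (rule prob_space_sample[OF H])
      let ?L = "\<lambda>x. r \<le> \<bar>(\<Sum>i<n. g (x i)) / real n - (\<integral>y. g y \<partial>H)\<bar>"
      have [measurable]: "(\<lambda>x. \<Sum>i<n. g (x i)) \<in> borel_measurable ?P"
      proof (intro borel_measurable_sum)
        fix i assume "i \<in> {..<n}"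
        thus "(\<lambda>x. g (x i)) \<in> borel_measurable ?P"
          using gi by (intro measurable_compose[OF _ borel_measurable_integrable[OF gi]] measurable_component_singleton)
      qed
      have "{x \<in> space ?P. ?L x} \<in> sets ?P" by measurable
      hence lln: "outer_measure_of ?P {x \<in> space ?P. ?L x} \<le> ennreal (\<epsilon> / 3)"
        using elim(3) by (simp add: P.emeasure_eq_measure ennreal_leI)
      have "outer_measure_of ?P {x \<in> space ?P. \<delta> / 2 < dist (\<theta>est n x) \<theta>\<^sub>0 \<or> ?L x}
          \<le> outer_measure_of ?P {x \<in> space ?P. \<delta> / 2 < dist (\<theta>est n x) \<theta>\<^sub>0} + outer_measure_of ?P {x \<in> space ?P. ?L x}"
        by (rule outer_measure_of_subset_Un_le) auto
      also have "\<dots> \<le> ennreal (\<epsilon> / 3) + ennreal (\<epsilon> / 3)" using elim(2) lln by (rule add_mono)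
      also have "\<dots> = ennreal (2 * \<epsilon> / 3)" using \<epsilon> by (simp flip: ennreal_plus)
      finally have two: "outer_measure_of ?P {x \<in> space ?P. \<delta> / 2 < dist (\<theta>est n x) \<theta>\<^sub>0 \<or> ?L x} \<le> ennreal (2 * \<epsilon> / 3)" .
      have big: "a + 1 < T n x"
        if x: "x \<in> space ?P" and d: "\<not> \<delta> / 2 < dist (\<theta>est n x) \<theta>\<^sub>0" and l: "\<not> ?L x" for x
      proof -
        have xA: "x \<in> space (\<Pi>\<^sub>M i\<in>{..<n}. A)" using x unfolding space_PiM_cong_sets[OF sets_D[OF H]] .
        have "\<phi> (emb (empirical A n x)) = (\<Sum>i<n. g (x i)) / real n"
          unfolding g_def by (rule functional_of_empirical_measure[OF rep gA[unfolded g_def[abs_def]] elim(5) xA]) auto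
        with l have 1: "\<bar>\<phi> (emb (empirical A n x)) - \<phi> (emb H)\<bar> < r" by (simp add: gH)
        have 2: "\<bar>\<phi> (emb (Hm (\<theta>est n x))) - \<phi> (emb (Hm \<theta>\<^sub>0))\<bar> < r"
          using \<delta>(2)[of "\<theta>est n x"] d \<delta>(1) by (simp add: dist_real_def)
        let ?v = "emb (empirical A n x) - emb (Hm (\<theta>est n x))"
        have "r < \<bar>\<phi> (emb (empirical A n x)) - \<phi> (emb (Hm (\<theta>est n x)))\<bar>"
        proof -
          have tri: "\<bar>p - q\<bar> \<le> \<bar>u - p\<bar> + \<bar>u - v\<bar> + \<bar>v - q\<bar>" for p q u v :: real by linarith
          have "3 * r = \<bar>\<phi> (emb H) - \<phi> (emb (Hm \<theta>\<^sub>0))\<bar>" by (simp add: r_def)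
          also note tri[of _ _ "\<phi> (emb (empirical A n x))" "\<phi> (emb (Hm (\<theta>est n x)))"]
          finally show ?thesis using 1 2 by simp
        qed
        also have "\<dots> = norm (\<phi> ?v)" by (simp add: blinfun.diff_right)
        also have "\<dots> \<le> norm \<phi> * norm ?v" by (rule norm_blinfun)
        also have "\<dots> \<le> K * norm ?v" by (simp add: K_def mult_right_mono)
        finally have v: "r / K < norm ?v" using K by (simp add: field_simps)
        have "a + 1 < sqrt (real n) * (r / K)" using elim(4) K r by (simp add: field_simps)
        also have "\<dots> \<le> sqrt (real n) * norm ?v" using v by (intro mult_left_mono) auto
        finally show ?thesis by (simp add: gof_stat_def)
      qed
      have "outer_measure_of (joint_law n H)
          {(x, z) \<in> space (joint_law n H). \<not> \<xi> n x < T n x} \<le> ennreal (\<epsilon> / 3 + 2 * \<epsilon> / 3)"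
      proof (rule outer_measure_of_sample_event_le[OF _ elim(1) two])
        show "{x \<in> space ?P. \<not> \<xi> n x < T n x} \<subseteq> {x \<in> space ?P. \<not> \<xi> n x < a + 1} \<union>
            {x \<in> space ?P. \<delta> / 2 < dist (\<theta>est n x) \<theta>\<^sub>0 \<or> ?L x}"
          using big less_trans by blast
      qed (use \<epsilon> in auto)
      hence "ennreal (1 - (\<epsilon> / 3 + 2 * \<epsilon> / 3)) \<le>
          inner_measure_of (joint_law n H) {(x, z) \<in> space (joint_law n H). \<xi> n x < T n x}"
        using \<epsilon> by (intro inner_measure_of_sample_event_ge P.prob_space_axioms) auto
      thus ?case by simp
    qed
  qed
  have "(\<lambda>n. inner_measure_of (joint_law n H) {(x, z) \<in> space (joint_law n H). \<xi> n x < T n x}) \<longlonglongrightarrow> ennreal 1"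
  proof (rule tendsto_ennreal_if_eventually_between[OF _ low])
    show "\<forall>\<^sub>F n in sequentially. inner_measure_of (joint_law n H)
        {(x, z) \<in> space (joint_law n H). \<xi> n x < T n x} \<le> ennreal (1 + \<epsilon>)" if "0 < \<epsilon>" for \<epsilon>
    proof (intro always_eventually allI)
      fix n
      have "inner_measure_of (joint_law n H) {(x, z) \<in> space (joint_law n H). \<xi> n x < T n x} \<le> 1"
        unfolding inner_measure_of_def
        using prob_space.emeasure_le_1[OF prob_space_pair[OF prob_space_sample[OF H] Q]] by (auto intro: SUP_least)
      also have "1 \<le> ennreal (1 + \<epsilon>)" using that by (simp flip: ennreal_1)
      finally show "inner_measure_of (joint_law n H) {(x, z) \<in> space (joint_law n H). \<xi> n x < T n x} \<le> ennreal (1 + \<epsilon>)" .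
    qed
  qed auto
  thus ?thesis by simp
qed

end

theorem lemma5p4:
  fixes A :: "'x measure"
    and D :: "'x measure set"
    and emb :: "'x measure \<Rightarrow> 'e::real_normed_vector"
    and \<Theta> :: "(real^'d) set"
    and Hm :: "real^'d \<Rightarrow> 'x measure"
    and dH :: "real^'d \<Rightarrow> (real^'d) \<Rightarrow>\<^sub>L 'e"
    and \<theta> :: "'x measure \<Rightarrow> real^'d"
    and \<theta>est :: "nat \<Rightarrow> (nat \<Rightarrow> 'x) \<Rightarrow> real^'d"
    and N :: "'x measure \<Rightarrow> 'w measure"
    and G :: "'x measure \<Rightarrow> 'w \<Rightarrow> 'e"
    and U :: "'x measure \<Rightarrow> 'w \<Rightarrow> real^'d"
    and Q :: "'z measure"
    and Xs :: "nat \<Rightarrow> (nat \<Rightarrow> 'x) \<Rightarrow> 'z \<Rightarrow> (nat \<Rightarrow> 'x)"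
    and \<xi> :: "nat \<Rightarrow> (nat \<Rightarrow> 'x) \<Rightarrow> real"
    and \<alpha> :: real
  assumes D: "D \<subseteq> space (prob_algebra A)"
    and model: "Hm ` \<Theta> \<subseteq> D"
    and emb: "measure_embedding A D emb"
    and open_Theta: "open \<Theta>"
    and differentiable: "continuously_hadamard_differentiable (\<lambda>t. emb (Hm t)) dH \<Theta>"
    and separated: "\<And>H. H \<in> D - Hm ` \<Theta> \<Longrightarrow> (INF t\<in>\<Theta>. norm (emb H - emb (Hm t))) > 0"
    and theta_in: "\<And>H. H \<in> D \<Longrightarrow> \<theta> H \<in> \<Theta>"
    and theta_H0: "\<And>H. H \<in> Hm ` \<Theta> \<Longrightarrow> H = Hm (\<theta> H)"
    and est_in: "\<And>n x. 1 \<le> n \<Longrightarrow> x \<in> space (\<Pi>\<^sub>M i\<in>{..<n}. A) \<Longrightarrow> \<theta>est n x \<in> \<Theta>"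
    and limits: "\<And>H. H \<in> D \<Longrightarrow> tight_random_element (N H) (\<lambda>w. (G H w, U H w))"
    and Q: "prob_space Q"
    and bootstrap: "\<And>n. 1 \<le> n \<Longrightarrow> bootstrap_sample A Q n (\<lambda>x. Hm (\<theta>est n x)) (Xs n)"
    and boot_stat_measurable:
      "\<And>n x. 1 \<le> n \<Longrightarrow> x \<in> space (\<Pi>\<^sub>M i\<in>{..<n}. A) \<Longrightarrow>
         (\<lambda>z. boot_stat A emb Hm \<theta>est (\<lambda>x. Hm (\<theta>est n x)) n x (Xs n x z)) \<in> borel_measurable Q"
    and xi_measurable: "\<And>n. 1 \<le> n \<Longrightarrow> \<xi> n \<in> borel_measurable (\<Pi>\<^sub>M i\<in>{..<n}. A)"
    and xi_quantile:
      "\<And>n x. 1 \<le> n \<Longrightarrow> x \<in> space (\<Pi>\<^sub>M i\<in>{..<n}. A) \<Longrightarrow>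
         is_quantile (distr Q borel (\<lambda>z. boot_stat A emb Hm \<theta>est (\<lambda>x. Hm (\<theta>est n x)) n x (Xs n x z)))
           (1 - \<alpha>) (\<xi> n x)"
    and alpha: "0 < \<alpha>" "\<alpha> < 1"
    and no_atom:
      "\<And>H q. H \<in> Hm ` \<Theta> \<Longrightarrow>
         is_quantile (distr (N H) borel (\<lambda>w. norm (G H w - blinfun_apply (dH (\<theta> H)) (U H w))))
           (1 - \<alpha>) q \<Longrightarrow>
         measure (distr (N H) borel (\<lambda>w. norm (G H w - blinfun_apply (dH (\<theta> H)) (U H w)))) {q} = 0"
    and conditions:
      "(\<forall>H\<in>D.
          cond_B1 A emb \<theta>est H (\<theta> H) (N H) (\<lambda>w. (G H w, U H w)) \<and>
          cond_C1 A emb \<theta>est Hm (\<theta> H)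
            (N (Hm (\<theta> H))) (\<lambda>w. (G (Hm (\<theta> H)) w, U (Hm (\<theta> H)) w)))
       \<or>
       (\<forall>H\<in>Hm ` \<Theta>. cond_B1 A emb \<theta>est H (\<theta> H) (N H) (\<lambda>w. (G H w, U H w))) \<and>
       (\<forall>H\<in>D.
          cond_C2 A emb \<theta>est Hm (\<theta> H)
            (N (Hm (\<theta> H))) (\<lambda>w. (G (Hm (\<theta> H)) w, U (Hm (\<theta> H)) w)) \<and>
          consistent_under \<theta>est H (\<theta> H))"
  shows
    "(\<forall>H\<in>Hm ` \<Theta>.
        (\<lambda>n. outer_measure_of ((\<Pi>\<^sub>M i\<in>{..<n}. H) \<Otimes>\<^sub>M Q)
           {(x, z) \<in> space ((\<Pi>\<^sub>M i\<in>{..<n}. H) \<Otimes>\<^sub>M Q). gof_stat A emb Hm \<theta>est n x \<ge> \<xi> n x})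
          \<longlonglongrightarrow> ennreal \<alpha> \<and>
        (\<lambda>n. inner_measure_of ((\<Pi>\<^sub>M i\<in>{..<n}. H) \<Otimes>\<^sub>M Q)
           {(x, z) \<in> space ((\<Pi>\<^sub>M i\<in>{..<n}. H) \<Otimes>\<^sub>M Q). gof_stat A emb Hm \<theta>est n x \<ge> \<xi> n x})
          \<longlonglongrightarrow> ennreal \<alpha>) \<and>
     (\<forall>H\<in>D - Hm ` \<Theta>.
        (\<lambda>n. inner_measure_of ((\<Pi>\<^sub>M i\<in>{..<n}. H) \<Otimes>\<^sub>M Q)
           {(x, z) \<in> space ((\<Pi>\<^sub>M i\<in>{..<n}. H) \<Otimes>\<^sub>M Q). gof_stat A emb Hm \<theta>est n x > \<xi> n x})
          \<longlonglongrightarrow> 1)"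
proof -
  interpret parametric_bootstrap_test A D emb \<Theta> Hm dH \<theta>est Q Xs \<xi> \<alpha>
    using D model emb open_Theta differentiable Q bootstrap
      boot_stat_measurable[unfolded boot_stat_eq_gof_stat] xi_quantile[unfolded boot_stat_eq_gof_stat] alpha
    by (rule parametric_bootstrap_test.intro)
  have limit: "prob_space (N H)" "(\<lambda>w. (G H w, U H w)) \<in> borel_measurable (N H)" if "H \<in> D" for H
    using limits[OF that] by (auto simp: tight_random_element_def)
  have Hm_D: "Hm (\<theta> H) \<in> D" if "H \<in> D" for H
    using model theta_in[OF that] by blast
  \<comment> \<open>The two sets of conditions on the estimators differ only in how they yield this fact.\<close>
  have regular: "consistent_under \<theta>est H (\<theta> H) \<and>
      sequences_control A emb \<theta>est Hm H (\<theta> H) (N (Hm (\<theta> H))) (\<lambda>w. (G (Hm (\<theta> H)) w, U (Hm (\<theta> H)) w))"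
    if H: "H \<in> D" for H
    using conditions
  proof (elim disjE conjE)
    assume "\<forall>H\<in>D. cond_B1 A emb \<theta>est H (\<theta> H) (N H) (\<lambda>w. (G H w, U H w)) \<and>
          cond_C1 A emb \<theta>est Hm (\<theta> H)
            (N (Hm (\<theta> H))) (\<lambda>w. (G (Hm (\<theta> H)) w, U (Hm (\<theta> H)) w))"
    hence B1: "joint_limit A emb \<theta>est (\<lambda>_. H) (\<lambda>_. \<theta> H) (N H) (\<lambda>w. (G H w, U H w))"
      and C1: "cond_C1 A emb \<theta>est Hm (\<theta> H) (N (Hm (\<theta> H))) (\<lambda>w. (G (Hm (\<theta> H)) w, U (Hm (\<theta> H)) w))"
      using H by (auto simp: cond_B1_def)
    note tight = scaled_error_tight[OF B1 limit(1)[OF H] prob_space_D[OF H]]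
    show ?thesis
      using consistent_of_scaled_error_tight[OF tight] sequences_control_of_C1[OF sets_D[OF H] tight C1]
      by blast
  next
    assume "\<forall>H\<in>D. cond_C2 A emb \<theta>est Hm (\<theta> H)
            (N (Hm (\<theta> H))) (\<lambda>w. (G (Hm (\<theta> H)) w, U (Hm (\<theta> H)) w)) \<and>
          consistent_under \<theta>est H (\<theta> H)"
    with H show ?thesis using sequences_control_of_C2[OF sets_D[OF H]] by blast
  qed
  show ?thesis
  proof (intro conjI ballI)
    fix H assume H: "H \<in> Hm ` \<Theta>"
    hence HD: "H \<in> D" and eq: "Hm (\<theta> H) = H" using model theta_H0 by auto
    \<comment> \<open>Under the null hypothesis the limit of the statistic is the one that governs the bootstrap.\<close>
    have "joint_limit A emb \<theta>est (\<lambda>_. Hm (\<theta> H)) (\<lambda>_. \<theta> H) (N H) (\<lambda>w. (G H w, U H w))"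
      using conditions H HD unfolding cond_B1_def eq by blast
    note level = asymptotic_level[OF theta_in[OF HD] limit[OF HD] this]
    show "(\<lambda>n. outer_measure_of ((\<Pi>\<^sub>M i\<in>{..<n}. H) \<Otimes>\<^sub>M Q)
           {(x, z) \<in> space ((\<Pi>\<^sub>M i\<in>{..<n}. H) \<Otimes>\<^sub>M Q). gof_stat A emb Hm \<theta>est n x \<ge> \<xi> n x})
          \<longlonglongrightarrow> ennreal \<alpha>"
      using level(1) regular[OF HD] no_atom[OF H] unfolding eq by simp
    show "(\<lambda>n. inner_measure_of ((\<Pi>\<^sub>M i\<in>{..<n}. H) \<Otimes>\<^sub>M Q)
           {(x, z) \<in> space ((\<Pi>\<^sub>M i\<in>{..<n}. H) \<Otimes>\<^sub>M Q). gof_stat A emb Hm \<theta>est n x \<ge> \<xi> n x})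
          \<longlonglongrightarrow> ennreal \<alpha>"
      using level(2) regular[OF HD] no_atom[OF H] unfolding eq by simp
  next
    fix H assume H: "H \<in> D - Hm ` \<Theta>"
    hence HD: "H \<in> D" by blast
    have "(INF t\<in>\<Theta>. norm (emb H - emb (Hm t))) \<le> norm (emb H - emb (Hm (\<theta> H)))"
      by (rule cINF_lower[OF _ theta_in[OF HD]]) (auto intro: bdd_belowI[of _ 0])
    with separated[OF H] have "emb H \<noteq> emb (Hm (\<theta> H))" by auto
    thus "(\<lambda>n. inner_measure_of ((\<Pi>\<^sub>M i\<in>{..<n}. H) \<Otimes>\<^sub>M Q)
           {(x, z) \<in> space ((\<Pi>\<^sub>M i\<in>{..<n}. H) \<Otimes>\<^sub>M Q). gof_stat A emb Hm \<theta>est n x > \<xi> n x})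
          \<longlonglongrightarrow> 1"
      using regular[OF HD] limit[OF Hm_D[OF HD]] theta_in[OF HD] HD
      by (intro asymptotic_power) blast+
  qed
qed

end
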